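(* Let $\mathcal{G}=(\mathscr{S},\mathscr{C},\mathscr{R})$ be a reaction network with $d$ species, stoichiometric subspace $\mathcal{S}$ of dimension $s$, and let $C\in\mathbb{R}^{d-s,d}$ be a matrix whose rows form a basis of $\mathcal{S}^\perp$ (so $\ker C=\mathcal{S}$). Let $K^X=(\kappa^X_r)_{r\in\mathscr{R}}$ and $K^Y=(\kappa^Y_r)_{r\in\mathscr{R}}$ be two mass-action kinetics (non-negative rate constants). Choose $M \in \mathbb{Z}^{m,d}$ ($m\ge1$) and define $D = (M^\intercal \mid C^\intercal) \in \mathbb{R}^{d,m+d-s}$. Define $A,B \in \mathbb{R}^{m+1,d}$ by, for $i = 1,\dots,m+1$ and $j=1,\dots,d$: $A_{i,j} = 1$ if there exists $\alpha \in \mathbb{R}^{m+d-s}$ with $D\alpha = e_j$ and $\alpha_k \geq 0$ for all $k \in \{1,\dots,m\} \setminus \{i\}$, and $A_{i,j}=0$ otherwise; $B_{i,j} = 1$ if there exists $\beta \in \mathbb{R}^{m+d-s}$ with $D\beta = e_j$ and $\beta_k \leq 0$ for all $k \in \{1,\dots,m\} \setminus \{i\}$, and $B_{i,j}=0$ otherwise. (For $i=m+1$ the set $\{1,\dots,m\}\setminus\{i\}$ is all of $\{1,\dots,m\}$.) Suppose that each reaction $r \in \mathscr{R}$ satisfies at least one of (A1) $(M\xi_r)^+ = 0$; (A2) $A_{m+1,*} \odot \nu_r = \nu_r$ and $\kappa_r^X \leq \kappa_r^Y$; (A3) for some $i \in \{1,\dots,m\}$: $(M\xi_r)^+ = e_i$,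 $A_{i,*} \odot \nu_r = \nu_r$ and $\kappa_r^X \leq \kappa_r^Y$; and at least one of (B1) $(M\xi_r)^- = 0$; (B2) $B_{m+1,*} \odot \nu_r = \nu_r$ and $\kappa_r^X \geq \kappa_r^Y$; (B3) for some $i \in \{1,\dots,m\}$: $(M\xi_r)^- = e_i$, $B_{i,*} \odot \nu_r = \nu_r$ and $\kappa_r^X \geq \kappa_r^Y$. Then for every $x^0, y^0 \in \mathbb{Z}_{\geq 0}^d$ with $x^0-y^0 \in \mathcal{S}$ and $M(x^0-y^0)\le 0$, there exist two continuous-time Markov chains $X$ and $Y$ modeling $\mathcal{G}$ with mass-action kinetics $K^X$ and $K^Y$ respectively, defined on a common probability space, with $X(0) = x^0$, $Y(0) = y^0$ and $$\mathbb{P}\big(M(X(t)-Y(t))\le 0 \text{ for all } t \in [0, \tau^X \wedge \tau^Y)\big) = 1.$$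
   Context: A reaction network $\mathcal{G}=(\mathscr{S},\mathscr{C},\mathscr{R})$ consists of a finite set $\mathscr{S}$ of $d$ species, a finite set $\mathscr{C}$ of complexes identified with vectors in $\mathbb{Z}_{\ge0}^d$, and a finite set $\mathscr{R}$ of reactions $r=\nu_r\to\nu_r'$ with $\nu_r,\nu'_r\in\mathscr{C}$ (source and product complexes). The reaction vector is $\xi_r=\nu_r'-\nu_r\in\mathbb{Z}^d$, and the stoichiometric subspace is $\mathcal{S}=\mathrm{span}\{\xi_r\}_{r\in\mathscr{R}}$, of dimension $s$. A mass-action kinetics is a family of non-negative rate constants $K=(\kappa_r)_{r\in\mathscr{R}}$, with propensities $\lambda_r(x)=\kappa_r\prod_{j=1}^d (x_j)_{\nu_{r,j}}$, where $(x)_n=x(x-1)\cdots(x-n+1)$ is the falling factorial and $(x)_0=1$. The CTMC modeling $\mathcal{G}$ with kinetics $K$ has state space in $\mathbb{Z}_{\ge0}^d$ and transition rates $q(x,x')=\sum_{r\in\mathscr{R}:\ \xi_r=x'-x}\lambda_r(x)$ for $x\ne x'$. Notation: $e_1,\dots,e_d$ (or $e_i$ in $\mathbb{R}^m$) are canonical basis vectors; for a vector $v$, $v^{\pm}$ are the componentwise positive/negative parts; $\odot$ is the componentwise product; $A_{i,*}$ is the $i$-th row of $A$; inequalities between vectors are componentwise. The explosion time of a process $Z$ with values in $E$ is $\tau^Z=\inf\{t\ge0:\text{for every finite }\Gamma\subseteq E\text{ there exists } s<t \text{ with } Z(s)\notin\Gamma\}$. *)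

theory Defs
  imports "HOL-Probability.Probability"
begin

text \<open>Species are indexed by a finite type 'n (so d = CARD('n)), reactions by a
finite type 'r.  Reaction r is nu r -> nu' r with complexes in Z_{>=0}^d.\<close>

definition rvec :: "('r \<Rightarrow> 'n \<Rightarrow> nat) \<Rightarrow> ('r \<Rightarrow> 'n \<Rightarrow> nat) \<Rightarrow> 'r \<Rightarrow> 'n \<Rightarrow> int" where
  "rvec nu nu' r j = int (nu' r j) - int (nu r j)"

definition stoich_space :: "('r::finite \<Rightarrow> 'n \<Rightarrow> nat) \<Rightarrow> ('r \<Rightarrow> 'n \<Rightarrow> nat) \<Rightarrow> ('n \<Rightarrow> real) set" where
  "stoich_space nu nu' = {v. \<exists>c :: 'r \<Rightarrow> real. v = (\<lambda>j. \<Sum>r\<in>UNIV. c r * real_of_int (rvec nu nu' r j))}"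

definition orth_compl :: "('n::finite \<Rightarrow> real) set \<Rightarrow> ('n \<Rightarrow> real) set" where
  "orth_compl V = {w. \<forall>v\<in>V. (\<Sum>j\<in>UNIV. w j * v j) = 0}"

definition rows_basis_of :: "nat \<Rightarrow> (nat \<Rightarrow> 'n::finite \<Rightarrow> real) \<Rightarrow> ('n \<Rightarrow> real) set \<Rightarrow> bool" where
  "rows_basis_of k C W \<longleftrightarrow>
     (\<forall>i<k. C i \<in> W) \<and>
     (\<forall>a :: nat \<Rightarrow> real. (\<forall>j. (\<Sum>i<k. a i * C i j) = 0) \<longrightarrow> (\<forall>i<k. a i = 0)) \<and>
     (\<forall>w\<in>W. \<exists>a :: nat \<Rightarrow> real. w = (\<lambda>j. \<Sum>i<k. a i * C i j))"

definition falling_fact :: "real \<Rightarrow> nat \<Rightarrow> real" where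
  "falling_fact x n = (\<Prod>i<n. (x - real i))"

definition propensity :: "('r \<Rightarrow> real) \<Rightarrow> ('r \<Rightarrow> 'n::finite \<Rightarrow> nat) \<Rightarrow> 'r \<Rightarrow> ('n \<Rightarrow> nat) \<Rightarrow> real" where
  "propensity kappa nu r x = kappa r * (\<Prod>j\<in>UNIV. falling_fact (real (x j)) (nu r j))"

definition ma_rates :: "('r::finite \<Rightarrow> real) \<Rightarrow> ('r \<Rightarrow> 'n::finite \<Rightarrow> nat) \<Rightarrow> ('r \<Rightarrow> 'n \<Rightarrow> nat)
    \<Rightarrow> ('n \<Rightarrow> nat) \<Rightarrow> ('n \<Rightarrow> nat) \<Rightarrow> real" where
  "ma_rates kappa nu nu' x x' =
     (if x' \<noteq> x then (\<Sum>r\<in>{r. \<forall>j. int (x' j) - int (x j) = rvec nu nu' r j}. propensity kappa nu r x)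
      else 0)"

definition total_rate :: "('s \<Rightarrow> 's \<Rightarrow> real) \<Rightarrow> 's \<Rightarrow> real" where
  "total_rate q x = infsum (\<lambda>y. if y \<noteq> x then q x y else 0) UNIV"

definition jump_prob :: "('s \<Rightarrow> 's \<Rightarrow> real) \<Rightarrow> 's \<Rightarrow> 's \<Rightarrow> real" where
  "jump_prob q x y =
     (if total_rate q x > 0 then (if y \<noteq> x then q x y / total_rate q x else 0)
      else (if y = x then 1 else 0))"

text \<open>X is a CTMC on the probability space P with transition rates q started at x0:
  there are a jump chain Z and holding times S (values in [0,\<infinity>]) whose joint law is
  that of the discrete chain with jump matrix jump_prob q started at x0 and, conditionally
  on it, independent exponential holding times with parameters total_rate q (Z k);
  and X(t) = Z n for J_n \<le> t < J_(n+1), where J_n = S_0 + ... + S_(n-1).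
  (Values of X at or after the explosion time sup_n J_n are not constrained.)\<close>
definition is_ctmc :: "'w measure \<Rightarrow> ('s \<Rightarrow> 's \<Rightarrow> real) \<Rightarrow> 's \<Rightarrow> (real \<Rightarrow> 'w \<Rightarrow> 's) \<Rightarrow> bool" where
  "is_ctmc P q x0 X \<longleftrightarrow>
     (\<exists>(Z :: nat \<Rightarrow> 'w \<Rightarrow> 's) (S :: nat \<Rightarrow> 'w \<Rightarrow> ennreal).
        (\<forall>n. Z n \<in> measurable P (count_space UNIV)) \<and>
        (\<forall>n. S n \<in> borel_measurable P) \<and>
        (\<forall>(n::nat) (z :: nat \<Rightarrow> 's) (t :: nat \<Rightarrow> real).
            z 0 = x0 \<longrightarrow> (\<forall>k<n. 0 \<le> t k) \<longrightarrow>
            measure P {\<omega> \<in> space P. (\<forall>k\<le>n. Z k \<omega> = z k) \<and> (\<forall>k<n. ennreal (t k) < S k \<omega>)}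
              = (\<Prod>k<n. exp (- total_rate q (z k) * t k) * jump_prob q (z k) (z (Suc k)))) \<and>
        (\<forall>\<omega>\<in>space P. \<forall>(t::real) (n::nat). 0 \<le> t \<longrightarrow>
            (\<Sum>k<n. S k \<omega>) \<le> ennreal t \<longrightarrow> ennreal t < (\<Sum>k<Suc n. S k \<omega>) \<longrightarrow>
            X t \<omega> = Z n \<omega>))"

definition explosion_time :: "(real \<Rightarrow> 's) \<Rightarrow> ennreal" where
  "explosion_time z = Inf (ennreal ` {t. 0 \<le> t \<and>
      (\<forall>\<Gamma>. finite \<Gamma> \<longrightarrow> (\<exists>s. 0 \<le> s \<and> s < t \<and> z s \<notin> \<Gamma>))})"

text \<open>M is m x d (rows indexed by the finite type 'm, m = CARD('m) \<ge> 1), C has k = d - s rows.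
  D alpha = M^T alpha_M + C^T alpha_C.  Rows of A, B are indexed by 'm option, with
  Some i the i-th row and None the (m+1)-th row.\<close>
definition D_eq_e :: "('m::finite \<Rightarrow> 'n::finite \<Rightarrow> int) \<Rightarrow> nat \<Rightarrow> (nat \<Rightarrow> 'n \<Rightarrow> real)
    \<Rightarrow> ('m \<Rightarrow> real) \<Rightarrow> (nat \<Rightarrow> real) \<Rightarrow> 'n \<Rightarrow> bool" where
  "D_eq_e M k C a b j \<longleftrightarrow>
     (\<forall>j'. (\<Sum>i\<in>UNIV. a i * real_of_int (M i j')) + (\<Sum>l<k. b l * C l j') = (if j' = j then 1 else 0))"

definition matA :: "('m::finite \<Rightarrow> 'n::finite \<Rightarrow> int) \<Rightarrow> nat \<Rightarrow> (nat \<Rightarrow> 'n \<Rightarrow> real)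
    \<Rightarrow> 'm option \<Rightarrow> 'n \<Rightarrow> nat" where
  "matA M k C i j = (if \<exists>a b. D_eq_e M k C a b j \<and> (\<forall>l. Some l \<noteq> i \<longrightarrow> a l \<ge> 0) then 1 else 0)"

definition matB :: "('m::finite \<Rightarrow> 'n::finite \<Rightarrow> int) \<Rightarrow> nat \<Rightarrow> (nat \<Rightarrow> 'n \<Rightarrow> real)
    \<Rightarrow> 'm option \<Rightarrow> 'n \<Rightarrow> nat" where
  "matB M k C i j = (if \<exists>a b. D_eq_e M k C a b j \<and> (\<forall>l. Some l \<noteq> i \<longrightarrow> a l \<le> 0) then 1 else 0)"

definition matvec :: "('m \<Rightarrow> 'n::finite \<Rightarrow> int) \<Rightarrow> ('n \<Rightarrow> int) \<Rightarrow> 'm \<Rightarrow> int" where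
  "matvec M v i = (\<Sum>j\<in>UNIV. M i j * v j)"

definition pos_part :: "('m \<Rightarrow> int) \<Rightarrow> 'm \<Rightarrow> int" where
  "pos_part v i = max (v i) 0"

definition neg_part :: "('m \<Rightarrow> int) \<Rightarrow> 'm \<Rightarrow> int" where
  "neg_part v i = max (- v i) 0"

definition unit_vec :: "'m \<Rightarrow> 'm \<Rightarrow> int" where
  "unit_vec i l = (if l = i then 1 else 0)"

end

theory Submission
  imports Defs
begin

text \<open>
Let each reaction \<open>r\<close> fire simultaneously in \<open>X\<close> and \<open>Y\<close> at the minimum of its two propensities, and
in one of them alone at the excess of the larger propensity. From a pair with \<open>x - y\<close> in the
stoichiometric subspace and \<open>M (x - y) \<le> 0\<close>, a solution of \<open>D \<alpha> = e\<^sub>j\<close> expresses \<open>x\<^sub>j - y\<^sub>j\<close> as a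
combination of the entries of \<open>M (x - y)\<close>. The sign conditions (A2), (B2) then compare the
propensities so that the harmful solitary firing has rate zero, while under (A3), (B3) this
happens when the entry \<open>i\<close> of \<open>M (x - y)\<close> is \<open>0\<close>; otherwise that entry is at most \<open>-1\<close>, and changing
it by one is harmless.

The coupled chain \<open>W\<close> is only defined up to its own explosion, whereas each marginal must be
continued up to its own. For every \<open>N\<close>, following \<open>W\<close> for \<open>N\<close> steps and then running the marginal
chain on independent noise yields exactly the law of the marginal chain, by memorylessness and
induction on \<open>N\<close>. Along every realisation the jump chains become stationary and the holding
times converge as \<open>N\<close> grows, so the law passes to the limit. If \<open>W\<close> explodes, one of the two
marginals has jumped infinitely often and is itself exploded.
\<close>

section \<open>Jump distributions and driving noise\<close>

definition finite_rates :: "('s \<Rightarrow> 's \<Rightarrow> real) \<Rightarrow> bool" where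
  "finite_rates q \<longleftrightarrow> (\<forall>x y. 0 \<le> q x y) \<and> (\<forall>x. finite {y. q x y \<noteq> 0})"

lemma total_rate_eq_sum:
  assumes "finite {y. q x y \<noteq> 0}"
  shows "total_rate q x = (\<Sum>y | y \<noteq> x \<and> q x y \<noteq> 0. q x y)"
proof -
  have fin: "finite {y. y \<noteq> x \<and> q x y \<noteq> 0}"
    using assms by (rule rev_finite_subset) auto
  have "total_rate q x = infsum (q x) {y. y \<noteq> x \<and> q x y \<noteq> 0}"
    unfolding total_rate_def by (rule infsum_cong_neutral) auto
  then show ?thesis
    using fin by simp
qed

lemma total_rate_nonneg: "finite_rates q \<Longrightarrow> 0 \<le> total_rate q x"
  by (auto simp: finite_rates_def total_rate_eq_sum intro!: sum_nonneg)

lemma total_rate_pos_iff: "finite_rates q \<Longrightarrow> 0 < total_rate q x \<longleftrightarrow> total_rate q x \<noteq> 0"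
  using total_rate_nonneg[of q x] by auto

lemma jump_prob_nonneg: "finite_rates q \<Longrightarrow> 0 \<le> jump_prob q x y"
  by (auto simp: jump_prob_def finite_rates_def)

lemma nn_integral_jump_prob:
  assumes "finite_rates q"
  shows "(\<integral>\<^sup>+ y. ennreal (jump_prob q x y) \<partial>count_space UNIV) = 1"
proof (cases "total_rate q x > 0")
  case True
  let ?S = "{y. y \<noteq> x \<and> q x y \<noteq> 0}"
  have fin: "finite ?S"
    using assms by (auto simp: finite_rates_def intro: rev_finite_subset)
  have "(\<integral>\<^sup>+ y. ennreal (jump_prob q x y) \<partial>count_space UNIV) = (\<Sum>y\<in>?S. ennreal (jump_prob q x y))"
    using fin True by (intro nn_integral_count_space') (auto simp: jump_prob_def split: if_splits)
  also have "\<dots> = ennreal (\<Sum>y\<in>?S. jump_prob q x y)"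
    using jump_prob_nonneg[OF assms] by simp
  also have "(\<Sum>y\<in>?S. jump_prob q x y) = (\<Sum>y\<in>?S. q x y / total_rate q x)"
    using True by (intro sum.cong) (auto simp: jump_prob_def)
  also have "\<dots> = 1"
    using True total_rate_eq_sum[of q x] assms
    by (simp add: sum_divide_distrib[symmetric] finite_rates_def)
  finally show ?thesis by simp
next
  case False
  then have "(\<integral>\<^sup>+ y. ennreal (jump_prob q x y) \<partial>count_space UNIV) = (\<Sum>y\<in>{x}. ennreal (jump_prob q x y))"
    by (intro nn_integral_count_space') (auto simp: jump_prob_def)
  with False show ?thesis by (simp add: jump_prob_def)
qed

definition jump_pmf :: "('s \<Rightarrow> 's \<Rightarrow> real) \<Rightarrow> 's \<Rightarrow> 's pmf" where
  "jump_pmf q x = embed_pmf (jump_prob q x)"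

lemma pmf_jump_pmf: "finite_rates q \<Longrightarrow> pmf (jump_pmf q x) y = jump_prob q x y"
  unfolding jump_pmf_def by (intro pmf_embed_pmf jump_prob_nonneg nn_integral_jump_prob)

lemma set_jump_pmf: "finite_rates q \<Longrightarrow> set_pmf (jump_pmf q x) = {y. jump_prob q x y \<noteq> 0}"
  by (simp add: set_pmf_eq pmf_jump_pmf)

text \<open>One step of a chain consumes a pair \<open>(v, u)\<close>: \<open>v\<close> is a unit exponential to be rescaled
  by the current total rate, and \<open>u x\<close> is the successor of \<open>x\<close>, drawn independently for every
  possible current state \<open>x\<close>.\<close>

definition step_noise :: "('s::countable \<Rightarrow> 's \<Rightarrow> real) \<Rightarrow> (real \<times> ('s \<Rightarrow> 's)) measure" where
  "step_noise q = density lborel (exponential_density 1) \<Otimes>\<^sub>M PiM UNIV (\<lambda>x. measure_pmf (jump_pmf q x))"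

definition noise :: "('s::countable \<Rightarrow> 's \<Rightarrow> real) \<Rightarrow> (nat \<Rightarrow> real \<times> ('s \<Rightarrow> 's)) measure" where
  "noise q = PiM UNIV (\<lambda>_. step_noise q)"

lemma prob_space_succ_noise: "prob_space (PiM UNIV (\<lambda>x. measure_pmf (jump_pmf q x)))"
  by (intro prob_space_PiM measure_pmf.prob_space_axioms)

lemma prob_space_exponential_noise: "prob_space (density lborel (exponential_density 1))"
  by (rule prob_space_exponential_density) simp

lemma prob_space_step_noise: "prob_space (step_noise q)"
  unfolding step_noise_def
  by (intro prob_space_pair prob_space_succ_noise prob_space_exponential_noise)

lemma prob_space_noise: "prob_space (noise q)"
  unfolding noise_def by (intro prob_space_PiM prob_space_step_noise)

lemma sets_step_noise [measurable_cong]: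
  "sets (step_noise q) = sets (borel \<Otimes>\<^sub>M PiM UNIV (\<lambda>_. count_space UNIV))"
  unfolding step_noise_def by (intro sets_pair_measure_cong sets_PiM_cong) auto

lemma sets_noise [measurable_cong]:
  "sets (noise q) = sets (PiM UNIV (\<lambda>_. borel \<Otimes>\<^sub>M PiM UNIV (\<lambda>_. count_space UNIV)))"
  unfolding noise_def by (intro sets_PiM_cong sets_step_noise) simp

lemma space_step_noise [simp]: "space (step_noise q) = UNIV"
  using sets_eq_imp_space_eq[OF sets_step_noise[of q]] by (simp add: space_pair_measure space_PiM)

lemma space_noise [simp]: "space (noise q) = UNIV"
  by (simp add: noise_def space_PiM)

lemma nn_integral_noise:
  assumes [measurable]: "f \<in> borel_measurable (noise q)"
  shows "(\<integral>\<^sup>+c. f c \<partial>noise q) = (\<integral>\<^sup>+a. (\<integral>\<^sup>+c. f (case_nat a c) \<partial>noise q) \<partial>step_noise q)"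
proof -
  interpret S: prob_space "step_noise q" by (rule prob_space_step_noise)
  interpret N: prob_space "noise q" by (rule prob_space_noise)
  interpret Q: sequence_space "step_noise q" ..
  have iter: "distr (step_noise q \<Otimes>\<^sub>M noise q) (noise q) (\<lambda>(a, c). case_nat a c) = noise q"
    unfolding noise_def by (rule Q.PiM_iter)
  have [measurable]: "(\<lambda>(a, c). case_nat a c) \<in> step_noise q \<Otimes>\<^sub>M noise q \<rightarrow>\<^sub>M noise q"
    unfolding noise_def by measurable
  have "(\<integral>\<^sup>+c. f c \<partial>noise q) = (\<integral>\<^sup>+p. f (case_nat (fst p) (snd p)) \<partial>(step_noise q \<Otimes>\<^sub>M noise q))"
    by (subst iter[symmetric], subst nn_integral_distr) (auto simp: split_beta' iter)
  also have "\<dots> = (\<integral>\<^sup>+a. (\<integral>\<^sup>+c. f (case_nat a c) \<partial>noise q) \<partial>step_noise q)"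
  proof (subst N.nn_integral_fst[symmetric])
    have "(\<lambda>p. f (case p of (a, c) \<Rightarrow> case_nat a c)) \<in> borel_measurable (step_noise q \<Otimes>\<^sub>M noise q)"
      by measurable
    then show "(\<lambda>p. f (case_nat (fst p) (snd p))) \<in> borel_measurable (step_noise q \<Otimes>\<^sub>M noise q)"
      by (simp add: split_beta')
  qed simp
  finally show ?thesis .
qed

lemma nn_integral_step_noise:
  fixes q :: "'s::countable \<Rightarrow> 's \<Rightarrow> real"
  assumes f: "\<And>y. f y \<in> borel_measurable borel"
  shows "(\<integral>\<^sup>+a. f (snd a x) (fst a) \<partial>step_noise q)
    = (\<integral>\<^sup>+y. (\<integral>\<^sup>+v. f y v \<partial>density lborel (exponential_density 1)) \<partial>measure_pmf (jump_pmf q x))"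
proof -
  let ?E = "density lborel (exponential_density 1)"
  let ?U = "PiM UNIV (\<lambda>x. measure_pmf (jump_pmf q x))"
  interpret E: prob_space ?E by (rule prob_space_exponential_noise)
  interpret U: prob_space ?U by (rule prob_space_succ_noise)
  interpret pair_sigma_finite ?E ?U ..
  have m1: "(\<lambda>a. f (snd a x) (fst a)) \<in> borel_measurable (?E \<Otimes>\<^sub>M ?U)"
  proof (rule measurable_compose_countable[where f="\<lambda>y a. f y (fst a)" and g="\<lambda>a. snd a x"])
    show "(\<lambda>a. f y (fst a)) \<in> borel_measurable (?E \<Otimes>\<^sub>M ?U)" for y
      using f[of y] by measurable
    show "(\<lambda>a. snd a x) \<in> ?E \<Otimes>\<^sub>M ?U \<rightarrow>\<^sub>M count_space UNIV"
      by (rule measurable_compose[OF measurable_snd])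
         (rule measurable_compose[OF measurable_component_singleton], auto)
  qed
  have "(\<integral>\<^sup>+a. f (snd a x) (fst a) \<partial>step_noise q) = (\<integral>\<^sup>+u. (\<integral>\<^sup>+v. f (u x) v \<partial>?E) \<partial>?U)"
    unfolding step_noise_def using nn_integral_snd[OF m1] by simp
  also have "\<dots> = (\<integral>\<^sup>+y. (\<integral>\<^sup>+v. f y v \<partial>?E) \<partial>distr ?U (measure_pmf (jump_pmf q x)) (\<lambda>u. u x))"
    by (subst nn_integral_distr) auto
  also have "distr ?U (measure_pmf (jump_pmf q x)) (\<lambda>u. u x) = measure_pmf (jump_pmf q x)"
    by (rule distr_PiM_component) (auto intro: measure_pmf.prob_space_axioms)
  finally show ?thesis .
qed

lemma emeasure_exponential_noise_atLeast:
  assumes "0 \<le> b"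
  shows "emeasure (density lborel (exponential_density 1)) {b..} = ennreal (exp (- b))"
proof -
  have "(\<integral>\<^sup>+v. indicator {b..} v \<partial>density lborel (exponential_density 1))
      = (\<integral>\<^sup>+v. ennreal (exp (- v)) * indicator {b..} v \<partial>lborel)"
    using assms by (subst nn_integral_density)
      (auto simp: exponential_density_def indicator_def intro!: nn_integral_cong)
  also have "\<dots> = 0 - (- exp (- b))"
  proof (rule nn_integral_FTC_atLeast)
    show "((\<lambda>v::real. - exp (- v)) \<longlongrightarrow> 0) at_top"
      using tendsto_minus[OF filterlim_compose[OF exp_at_bot filterlim_uminus_at_bot_at_top]] by simp
  qed (auto intro!: derivative_eq_intros)
  finally show ?thesis by simp
qed

text \<open>Memorylessness: an exponential clock of rate \<open>l\<close> that is restarted when an independent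
  clock of rate \<open>a - l\<close> rings is still exponential of rate \<open>l\<close>.\<close>

lemma nn_integral_exponential_noise_residual:
  assumes a: "0 < a" and l: "0 \<le> l" "l \<le> a" and t: "0 \<le> t"
  shows "ennreal (l / a) * ennreal (exp (- a * t))
    + ennreal (1 - l / a) * (\<integral>\<^sup>+v. ennreal (exp (- l * max 0 (t - v / a))) \<partial>density lborel (exponential_density 1))
    = ennreal (exp (- l * t))"
proof (cases "l = a")
  case True
  then show ?thesis using a by simp
next
  case False
  define m where "m = a - l"
  have m: "m > 0" using False l by (simp add: m_def)
  have at: "0 \<le> a * t" using a t by simp
  let ?E = "density lborel (exponential_density 1)"
  define F where "F v = - (a / m) * exp (- l * t) * exp (- (m / a) * v)" for v
  have "(\<integral>\<^sup>+v. ennreal (exp (- l * max 0 (t - v / a))) \<partial>?E)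
    = (\<integral>\<^sup>+v. ennreal (exp (- l * t) * exp (- (m / a) * v)) * indicator {0..a * t} v
        + ennreal (exp (- v)) * indicator {a * t<..} v \<partial>lborel)"
  proof (subst nn_integral_density, simp, simp, rule nn_integral_cong)
    fix v :: real
    have "exp (- v) * exp (- l * max 0 (t - v / a)) = exp (- l * t) * exp (- (m / a) * v)" if "v \<le> a * t"
    proof -
      have "max 0 (t - v / a) = t - v / a" using that a by (simp add: field_simps)
      moreover have "- v + (- l * (t - v / a)) = - l * t + (- (m / a) * v)"
        using a by (simp add: m_def field_simps)
      ultimately show ?thesis by (simp only: exp_add[symmetric])
    qed
    moreover have "max 0 (t - v / a) = 0" if "v > a * t"
      using that a by (simp add: field_simps)
    ultimately show "ennreal (exponential_density 1 v) * ennreal (exp (- l * max 0 (t - v / a)))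
        = ennreal (exp (- l * t) * exp (- (m / a) * v)) * indicator {0..a * t} v
        + ennreal (exp (- v)) * indicator {a * t<..} v"
      using a t by (auto simp: exponential_density_def indicator_def ennreal_mult[symmetric] not_less
          dest: order.strict_trans1[OF at])
  qed
  also have "\<dots> = (\<integral>\<^sup>+v. ennreal (exp (- l * t) * exp (- (m / a) * v)) * indicator {0..a * t} v \<partial>lborel)
      + (\<integral>\<^sup>+v. ennreal (exp (- v)) * indicator {a * t<..} v \<partial>lborel)"
    by (rule nn_integral_add) auto
  also have "(\<integral>\<^sup>+v. ennreal (exp (- l * t) * exp (- (m / a) * v)) * indicator {0..a * t} v \<partial>lborel)
      = F (a * t) - F 0"
    using a t m unfolding F_def
    by (intro nn_integral_FTC_Icc) (auto intro!: derivative_eq_intros simp: field_simps)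
  also have "(\<integral>\<^sup>+v. ennreal (exp (- v)) * indicator {a * t<..} v \<partial>lborel)
      = (\<integral>\<^sup>+v. ennreal (exp (- v)) * indicator {a * t..} v \<partial>lborel)"
  proof (rule nn_integral_cong_AE)
    show "AE v in lborel. ennreal (exp (- v)) * indicator {a * t<..} v = ennreal (exp (- v)) * indicator {a * t..} v"
      using AE_lborel_singleton[of "a * t"] by eventually_elim (auto simp: indicator_def)
  qed
  also have "\<dots> = (\<integral>\<^sup>+v. indicator {a * t..} v \<partial>?E)"
  proof (subst nn_integral_density, simp, simp, rule nn_integral_cong)
    show "ennreal (exp (- v)) * indicator {a * t..} v = ennreal (exponential_density 1 v) * indicator {a * t..} v" for v
      using at by (cases "v < 0") (auto simp: exponential_density_def indicator_def)
  qed
  also have "\<dots> = ennreal (exp (- (a * t)))"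
    using at by (simp add: emeasure_exponential_noise_atLeast)
  finally have I: "(\<integral>\<^sup>+v. ennreal (exp (- l * max 0 (t - v / a))) \<partial>?E) = ennreal (F (a * t) - F 0) + ennreal (exp (- (a * t)))" .
  have F: "F (a * t) - F 0 = (a / m) * (exp (- l * t) - exp (- (a * t)))"
  proof -
    have "exp (- l * t) * exp (- (m / a) * (a * t)) = exp (- (a * t))"
      using a by (simp add: exp_add[symmetric] m_def field_simps)
    then have "F (a * t) = - (a / m) * exp (- (a * t))"
      by (simp add: F_def)
    moreover have "F 0 = - (a / m) * exp (- l * t)"
      by (simp add: F_def)
    ultimately show ?thesis
      by (simp add: algebra_simps)
  qed
  have nn: "0 \<le> F (a * t) - F 0"
    unfolding F using a m l t by (intro mult_nonneg_nonneg) (auto intro: mult_right_mono)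
  have ma: "1 - l / a = m / a"
    using a by (simp add: m_def field_simps)
  have "ennreal (l / a) * ennreal (exp (- a * t)) + ennreal (1 - l / a) * (ennreal (F (a * t) - F 0) + ennreal (exp (- (a * t))))
     = ennreal (l / a * exp (- a * t) + (m / a) * (F (a * t) - F 0 + exp (- (a * t))))"
    using a m l nn unfolding ma
    by (simp add: ennreal_plus[symmetric] ennreal_mult[symmetric] del: ennreal_plus)
  also have "l / a * exp (- a * t) + (m / a) * (F (a * t) - F 0 + exp (- (a * t))) = exp (- l * t)"
    unfolding F using a m by (simp add: field_simps) (simp add: m_def algebra_simps)
  finally show ?thesis
    unfolding I .
qed

primrec chain_state :: "nat \<Rightarrow> 's \<Rightarrow> (nat \<Rightarrow> real \<times> ('s \<Rightarrow> 's)) \<Rightarrow> 's" where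
  "chain_state 0 x c = x"
| "chain_state (Suc n) x c = chain_state n (snd (c 0) x) (\<lambda>i. c (Suc i))"

definition hold :: "('s \<Rightarrow> 's \<Rightarrow> real) \<Rightarrow> 's \<Rightarrow> real \<Rightarrow> ennreal" where
  "hold q x v = (if total_rate q x = 0 then \<infinity> else ennreal (v / total_rate q x))"

definition chain_hold :: "('s \<Rightarrow> 's \<Rightarrow> real) \<Rightarrow> nat \<Rightarrow> 's \<Rightarrow> (nat \<Rightarrow> real \<times> ('s \<Rightarrow> 's)) \<Rightarrow> ennreal" where
  "chain_hold q n x c = hold q (chain_state n x c) (fst (c n))"

lemma chain_hold_0 [simp]: "chain_hold q 0 x c = hold q x (fst (c 0))"
  by (simp add: chain_hold_def)

lemma chain_hold_Suc [simp]: "chain_hold q (Suc n) x c = chain_hold q n (snd (c 0) x) (\<lambda>i. c (Suc i))"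
  by (simp add: chain_hold_def)

lemma measurable_hold [measurable]: "hold q x \<in> borel_measurable borel"
  unfolding hold_def by measurable

lemma measurable_shift_noise [measurable]:
  "(\<lambda>c i. c (Suc i)) \<in> noise q \<rightarrow>\<^sub>M noise q"
  unfolding noise_def by (intro measurable_PiM_single') auto

lemma measurable_noise_state [measurable]:
  "(\<lambda>c. snd (c n) x) \<in> noise q \<rightarrow>\<^sub>M count_space UNIV"
proof -
  have "(\<lambda>c. snd (c n)) \<in> noise q \<rightarrow>\<^sub>M PiM UNIV (\<lambda>_. count_space UNIV)"
    by measurable
  then show ?thesis
    by (rule measurable_compose) measurable
qed

lemma measurable_noise_time [measurable]:
  "(\<lambda>c. fst (c n)) \<in> borel_measurable (noise q)"
  by measurable

lemma measurable_chain_state [measurable]: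
  "chain_state n x \<in> noise q \<rightarrow>\<^sub>M count_space UNIV"
proof (induction n arbitrary: x)
  case 0
  have "chain_state 0 x = (\<lambda>c. x)" by auto
  then show ?case by simp
next
  case (Suc n)
  have "(\<lambda>c. chain_state n y (\<lambda>i. c (Suc i))) \<in> noise q \<rightarrow>\<^sub>M count_space UNIV" for y
    by (rule measurable_compose[OF measurable_shift_noise Suc.IH])
  then show ?case
    by (simp add: measurable_compose_countable[OF _ measurable_noise_state])
qed

lemma measurable_chain_hold [measurable]:
  "chain_hold q' n x \<in> borel_measurable (noise q)"
  unfolding chain_hold_def
  by (rule measurable_compose_countable[OF _ measurable_chain_state]) measurable

definition seq_event :: "nat \<Rightarrow> (nat \<Rightarrow> 's) \<Rightarrow> (nat \<Rightarrow> real) \<Rightarrow> (nat \<Rightarrow> 's) \<Rightarrow> (nat \<Rightarrow> ennreal) \<Rightarrow> bool" where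
  "seq_event n z t Z S \<longleftrightarrow> (\<forall>k\<le>n. Z k = z k) \<and> (\<forall>k<n. ennreal (t k) \<le> S k)"

definition path_prob :: "('s \<Rightarrow> 's \<Rightarrow> real) \<Rightarrow> nat \<Rightarrow> (nat \<Rightarrow> 's) \<Rightarrow> (nat \<Rightarrow> real) \<Rightarrow> real" where
  "path_prob q n z t = (\<Prod>k<n. exp (- total_rate q (z k) * t k) * jump_prob q (z k) (z (Suc k)))"

lemma seq_event_0 [simp]: "seq_event 0 z t Z S \<longleftrightarrow> Z 0 = z 0"
  by (simp add: seq_event_def)

lemma seq_event_Suc:
  "seq_event (Suc n) z t Z S \<longleftrightarrow> Z 0 = z 0 \<and> ennreal (t 0) \<le> S 0 \<and>
     seq_event n (\<lambda>i. z (Suc i)) (\<lambda>i. t (Suc i)) (\<lambda>i. Z (Suc i)) (\<lambda>i. S (Suc i))"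
  unfolding seq_event_def by (auto simp: All_less_Suc2 less_Suc_eq_le[symmetric])

lemma path_prob_0 [simp]: "path_prob q 0 z t = 1"
  by (simp add: path_prob_def)

lemma path_prob_Suc:
  "path_prob q (Suc n) z t = exp (- total_rate q (z 0) * t 0) * jump_prob q (z 0) (z (Suc 0))
     * path_prob q n (\<lambda>i. z (Suc i)) (\<lambda>i. t (Suc i))"
  unfolding path_prob_def by (subst prod.lessThan_Suc_shift) simp

lemma path_prob_nonneg: "finite_rates q \<Longrightarrow> 0 \<le> path_prob q n z t"
  unfolding path_prob_def by (intro prod_nonneg) (auto intro!: mult_nonneg_nonneg jump_prob_nonneg)

lemma measurable_seq_event:
  assumes [measurable]: "\<And>k. (\<lambda>p. Z p k) \<in> M \<rightarrow>\<^sub>M count_space UNIV" "\<And>k. (\<lambda>p. S p k) \<in> borel_measurable M"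
  shows "Measurable.pred M (\<lambda>p. seq_event n z t (Z p) (S p))"
  unfolding seq_event_def by measurable

lemma chain_law:
  fixes q :: "'s::countable \<Rightarrow> 's \<Rightarrow> real"
  assumes q: "finite_rates q"
  assumes "z 0 = x" "\<And>k. k < n \<Longrightarrow> 0 \<le> t k"
  shows "(\<integral>\<^sup>+c. (if seq_event n z t (\<lambda>k. chain_state k x c) (\<lambda>k. chain_hold q k x c) then 1 else 0) \<partial>noise q)
    = ennreal (path_prob q n z t)"
  using assms(2-)
proof (induction n arbitrary: x z t)
  case 0
  interpret prob_space "noise q" by (rule prob_space_noise)
  from 0 show ?case by (simp add: emeasure_space_1[simplified])
next
  case (Suc n)
  note [measurable] = measurable_seq_event
  let ?z = "\<lambda>i. z (Suc i)" and ?t = "\<lambda>i. t (Suc i)"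
  let ?E = "density lborel (exponential_density 1)"
  let ?a = "total_rate q x"
  let ?R = "path_prob q n ?z ?t"
  have "(\<integral>\<^sup>+c. (if seq_event (Suc n) z t (\<lambda>k. chain_state k x c) (\<lambda>k. chain_hold q k x c) then 1 else 0) \<partial>noise q)
    = (\<integral>\<^sup>+a. (\<integral>\<^sup>+c. (if ennreal (t 0) \<le> hold q x (fst a) \<and> 
          seq_event n ?z ?t (\<lambda>k. chain_state k (snd a x) c) (\<lambda>k. chain_hold q k (snd a x) c) then 1 else 0) \<partial>noise q) \<partial>step_noise q)"
    using Suc.prems by (subst nn_integral_noise) (simp_all add: seq_event_Suc)
  also have "\<dots> = (\<integral>\<^sup>+a. (if ennreal (t 0) \<le> hold q x (fst a) then 1 else 0) *
      (if snd a x = z (Suc 0) then ennreal ?R else 0) \<partial>step_noise q)"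
  proof (rule nn_integral_cong)
    fix a :: "real \<times> ('s \<Rightarrow> 's)"
    have ne: "\<not> seq_event n ?z ?t (\<lambda>k. chain_state k (snd a x) c) (\<lambda>k. chain_hold q k (snd a x) c)" 
      if "snd a x \<noteq> z (Suc 0)" for c
      using that by (auto simp: seq_event_def intro!: exI[of _ 0])
    show "(\<integral>\<^sup>+c. (if ennreal (t 0) \<le> hold q x (fst a) \<and> 
          seq_event n ?z ?t (\<lambda>k. chain_state k (snd a x) c) (\<lambda>k. chain_hold q k (snd a x) c) then 1 else 0) \<partial>noise q)
      = (if ennreal (t 0) \<le> hold q x (fst a) then 1 else 0) * (if snd a x = z (Suc 0) then ennreal ?R else 0)"
      using Suc.IH[of ?z "snd a x" ?t] Suc.prems ne by auto
  qed
  also have "\<dots> = (\<integral>\<^sup>+y. (\<integral>\<^sup>+v. (if ennreal (t 0) \<le> hold q x v then 1 else 0) *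
      (if y = z (Suc 0) then ennreal ?R else 0) \<partial>?E) \<partial>jump_pmf q x)"
    by (rule nn_integral_step_noise[where f="\<lambda>y v. (if ennreal (t 0) \<le> hold q x v then 1 else 0) *
      (if y = z (Suc 0) then ennreal ?R else 0)"]) measurable
  also have "\<dots> = (\<integral>\<^sup>+y. (\<integral>\<^sup>+v. (if ennreal (t 0) \<le> hold q x v then 1 else 0) \<partial>?E) * ennreal ?R * indicator {z (Suc 0)} y \<partial>jump_pmf q x)"
    by (intro nn_integral_cong) (auto simp: nn_integral_multc indicator_def)
  also have "\<dots> = (\<integral>\<^sup>+v. (if ennreal (t 0) \<le> hold q x v then 1 else 0) \<partial>?E) * ennreal ?R * jump_prob q x (z (Suc 0))"
    by (subst nn_integral_cmult_indicator) (auto simp: emeasure_pmf_single pmf_jump_pmf[OF q])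
  also have "(\<integral>\<^sup>+v. (if ennreal (t 0) \<le> hold q x v then 1 else 0) \<partial>?E) = ennreal (exp (- ?a * t 0))"
  proof (cases "?a = 0")
    case True
    interpret prob_space ?E by (rule prob_space_exponential_noise)
    from True show ?thesis using emeasure_space_1 by (simp add: hold_def)
  next
    case False
    then have a: "?a > 0" using q by (simp add: total_rate_pos_iff)
    have t0: "0 \<le> t 0" using Suc.prems by simp
    have "(\<integral>\<^sup>+v. (if ennreal (t 0) \<le> hold q x v then 1 else 0) \<partial>?E) = (\<integral>\<^sup>+v. indicator {?a * t 0..} v \<partial>?E)"
    proof (rule nn_integral_cong_AE)
      have "AE v in ?E. 0 \<le> v"
        by (subst AE_density) (auto simp: exponential_density_def)
      then show "AE v in ?E. (if ennreal (t 0) \<le> hold q x v then 1 else 0) = (indicator {?a * t 0..} v :: ennreal)"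
      proof eventually_elim
        case (elim v)
        with a t0 show ?case by (auto simp: hold_def indicator_def field_simps)
      qed
    qed
    then show ?thesis
      using a t0 by (simp add: emeasure_exponential_noise_atLeast)
  qed
  finally show ?case
    using Suc.prems path_prob_nonneg[OF q] jump_prob_nonneg[OF q]
    by (simp add: path_prob_Suc ennreal_mult'[symmetric] ac_simps)
qed

section \<open>Lumped chains\<close>

text \<open>The projection of a chain to its lumped states, read off from the first \<open>N\<close> steps;
  after step \<open>N\<close> the lumped chain is continued with the independent noise \<open>e\<close>.\<close>

primrec lump_state :: "('w \<Rightarrow> 's) \<Rightarrow> nat \<Rightarrow> 'w \<Rightarrow> (nat \<Rightarrow> real \<times> ('w \<Rightarrow> 'w)) \<Rightarrow> (nat \<Rightarrow> real \<times> ('s \<Rightarrow> 's)) \<Rightarrow> nat \<Rightarrow> 's" where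
  "lump_state pr 0 w c e k = chain_state k (pr w) e"
| "lump_state pr (Suc N) w c e k =
    (if pr (snd (c 0) w) \<noteq> pr w
     then case k of 0 \<Rightarrow> pr w | Suc k' \<Rightarrow> lump_state pr N (snd (c 0) w) (\<lambda>i. c (Suc i)) e k'
     else lump_state pr N (snd (c 0) w) (\<lambda>i. c (Suc i)) e k)"

primrec lump_hold :: "('w \<Rightarrow> 's) \<Rightarrow> ('w \<Rightarrow> 'w \<Rightarrow> real) \<Rightarrow> ('s \<Rightarrow> 's \<Rightarrow> real) \<Rightarrow> nat \<Rightarrow> 'w
    \<Rightarrow> (nat \<Rightarrow> real \<times> ('w \<Rightarrow> 'w)) \<Rightarrow> (nat \<Rightarrow> real \<times> ('s \<Rightarrow> 's)) \<Rightarrow> nat \<Rightarrow> ennreal" where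
  "lump_hold pr qW q 0 w c e k = chain_hold q k (pr w) e"
| "lump_hold pr qW q (Suc N) w c e k =
    (if pr (snd (c 0) w) \<noteq> pr w
     then case k of 0 \<Rightarrow> hold qW w (fst (c 0)) | Suc k' \<Rightarrow> lump_hold pr qW q N (snd (c 0) w) (\<lambda>i. c (Suc i)) e k'
     else (if k = 0 then hold qW w (fst (c 0)) else 0) + lump_hold pr qW q N (snd (c 0) w) (\<lambda>i. c (Suc i)) e k)"

lemma measurable_pair_noise_state [measurable]:
  "(\<lambda>p. snd (fst p n) x) \<in> noise q \<Otimes>\<^sub>M N \<rightarrow>\<^sub>M count_space UNIV"
  by (rule measurable_compose[OF measurable_fst measurable_noise_state])

lemma measurable_pair_shift_noise [measurable]:
  "(\<lambda>p. (\<lambda>i. fst p (Suc i), snd p)) \<in> noise q \<Otimes>\<^sub>M N \<rightarrow>\<^sub>M noise q \<Otimes>\<^sub>M N"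
  by (intro measurable_Pair measurable_compose[OF measurable_fst measurable_shift_noise]) measurable

lemma measurable_lump_state:
  "(\<lambda>p. lump_state pr N w (fst p) (snd p) k) \<in> noise qW \<Otimes>\<^sub>M noise q \<rightarrow>\<^sub>M count_space UNIV"
proof (induction N arbitrary: w k)
  case 0
  show ?case
    by simp
next
  case (Suc N)
  have [measurable]: "(\<lambda>p. lump_state pr N v (\<lambda>i. fst p (Suc i)) (snd p) k) \<in> noise qW \<Otimes>\<^sub>M noise q \<rightarrow>\<^sub>M count_space UNIV" for v k
    using measurable_compose[OF measurable_pair_shift_noise Suc.IH] by simp
  let ?f = "\<lambda>v p. if pr v \<noteq> pr w
     then case k of 0 \<Rightarrow> pr w | Suc k' \<Rightarrow> lump_state pr N v (\<lambda>i. fst p (Suc i)) (snd p) k'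
     else lump_state pr N v (\<lambda>i. fst p (Suc i)) (snd p) k"
  have "(\<lambda>p. ?f (snd (fst p 0) w) p) \<in> noise qW \<Otimes>\<^sub>M noise q \<rightarrow>\<^sub>M count_space UNIV"
    by (rule measurable_compose_countable[OF _ measurable_pair_noise_state]) (cases k; simp)
  then show ?case by simp
qed

lemma measurable_lump_hold:
  "(\<lambda>p. lump_hold pr qW q N w (fst p) (snd p) k) \<in> borel_measurable (noise qW' \<Otimes>\<^sub>M noise q')"
proof (induction N arbitrary: w k)
  case 0
  show ?case
    by simp
next
  case (Suc N)
  have [measurable]: "(\<lambda>p. lump_hold pr qW q N v (\<lambda>i. fst p (Suc i)) (snd p) k) \<in> borel_measurable (noise qW' \<Otimes>\<^sub>M noise q')" for v k
    using measurable_compose[OF measurable_pair_shift_noise Suc.IH] by simp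
  let ?f = "\<lambda>v p. if pr v \<noteq> pr w
     then case k of 0 \<Rightarrow> hold qW w (fst (fst p 0)) | Suc k' \<Rightarrow> lump_hold pr qW q N v (\<lambda>i. fst p (Suc i)) (snd p) k'
     else (if k = 0 then hold qW w (fst (fst p 0)) else 0) + lump_hold pr qW q N v (\<lambda>i. fst p (Suc i)) (snd p) k"
  have [measurable]: "(\<lambda>p. hold qW w (fst (fst p 0))) \<in> borel_measurable (noise qW' \<Otimes>\<^sub>M noise q')"
    by (rule measurable_compose[OF measurable_fst measurable_compose[OF measurable_noise_time measurable_hold]])
  have "(\<lambda>p. ?f (snd (fst p 0) w) p) \<in> borel_measurable (noise qW' \<Otimes>\<^sub>M noise q')"
    by (rule measurable_compose_countable[OF _ measurable_pair_noise_state]) (cases k; simp)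
  then show ?case by simp
qed

lemma lump_state_0 [simp]: "lump_state pr N w c e 0 = pr w"
  by (induction N arbitrary: w c) auto

locale lumping =
  fixes qW :: "'w::countable \<Rightarrow> 'w \<Rightarrow> real" and q :: "'s::countable \<Rightarrow> 's \<Rightarrow> real" and pr :: "'w \<Rightarrow> 's"
  assumes finite_qW: "finite_rates qW" and finite_q: "finite_rates q"
    and marginal: "\<And>w z. z \<noteq> pr w \<Longrightarrow> (\<Sum>w' | qW w w' \<noteq> 0 \<and> pr w' = z. qW w w') = q (pr w) z"
begin

lemma sum_leaving_eq_total_rate: "(\<Sum>w' | qW w w' \<noteq> 0 \<and> pr w' \<noteq> pr w. qW w w') = total_rate q (pr w)"
proof -
  let ?S = "{w'. qW w w' \<noteq> 0 \<and> pr w' \<noteq> pr w}"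
  have fin: "finite {w'. qW w w' \<noteq> 0}" "finite {z. q (pr w) z \<noteq> 0}"
    using finite_qW finite_q by (auto simp: finite_rates_def)
  then have finS: "finite ?S" by (auto intro: rev_finite_subset)
  have "(\<Sum>w'\<in>?S. qW w w') = (\<Sum>z\<in>pr ` ?S. \<Sum>w'\<in>{w'\<in>?S. pr w' = z}. qW w w')"
    by (rule sum.image_gen[OF finS])
  also have "\<dots> = (\<Sum>z\<in>pr ` ?S. q (pr w) z)"
  proof (rule sum.cong[OF refl])
    fix z assume z: "z \<in> pr ` ?S"
    then have "{w'\<in>?S. pr w' = z} = {w'. qW w w' \<noteq> 0 \<and> pr w' = z}" by auto
    with z marginal[of z w] show "(\<Sum>w'\<in>{w'\<in>?S. pr w' = z}. qW w w') = q (pr w) z" by auto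
  qed
  also have "\<dots> = (\<Sum>z | z \<noteq> pr w \<and> q (pr w) z \<noteq> 0. q (pr w) z)"
  proof (rule sum.mono_neutral_cong_right)
    show "{z. z \<noteq> pr w \<and> q (pr w) z \<noteq> 0} \<subseteq> pr ` ?S"
    proof safe
      fix z assume z: "z \<noteq> pr w" "q (pr w) z \<noteq> 0"
      with marginal[of z w] have "{w'. qW w w' \<noteq> 0 \<and> pr w' = z} \<noteq> {}" by (metis sum.empty)
      with z show "z \<in> pr ` ?S" by auto
    qed
  qed (use finS in auto)
  also have "\<dots> = total_rate q (pr w)"
    using fin by (simp add: total_rate_eq_sum)
  finally show ?thesis .
qed

lemma total_rate_le: "total_rate q (pr w) \<le> total_rate qW w"
proof -
  have fin: "finite {w'. qW w w' \<noteq> 0}" and nn: "\<And>w'. 0 \<le> qW w w'"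
    using finite_qW by (auto simp: finite_rates_def)
  have "(\<Sum>w' | qW w w' \<noteq> 0 \<and> pr w' \<noteq> pr w. qW w w') \<le> (\<Sum>w' | w' \<noteq> w \<and> qW w w' \<noteq> 0. qW w w')"
    using fin nn by (intro sum_mono2) (auto intro: rev_finite_subset)
  then show ?thesis
    using fin by (simp add: sum_leaving_eq_total_rate total_rate_eq_sum)
qed

lemma prob_jump_pmf:
  assumes "total_rate qW w > 0" "w \<notin> A"
  shows "measure_pmf.prob (jump_pmf qW w) A = (\<Sum>w' | qW w w' \<noteq> 0 \<and> w' \<in> A. qW w w') / total_rate qW w"
proof -
  have fin: "finite {w'. qW w w' \<noteq> 0}"
    using finite_qW by (auto simp: finite_rates_def)
  have "measure_pmf.prob (jump_pmf qW w) A = measure_pmf.prob (jump_pmf qW w) (A \<inter> set_pmf (jump_pmf qW w))"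
    by (rule measure_Int_set_pmf[symmetric])
  also have "A \<inter> set_pmf (jump_pmf qW w) = {w'. qW w w' \<noteq> 0 \<and> w' \<in> A}"
    using assms by (auto simp: set_jump_pmf[OF finite_qW] jump_prob_def split: if_splits)
  also have "measure_pmf.prob (jump_pmf qW w) \<dots> = (\<Sum>w' | qW w w' \<noteq> 0 \<and> w' \<in> A. pmf (jump_pmf qW w) w')"
    using fin by (intro measure_measure_pmf_finite) (auto intro: rev_finite_subset)
  also have "\<dots> = (\<Sum>w' | qW w w' \<noteq> 0 \<and> w' \<in> A. qW w w' / total_rate qW w)"
    using assms by (intro sum.cong) (auto simp: pmf_jump_pmf[OF finite_qW] jump_prob_def)
  finally show ?thesis
    by (simp add: sum_divide_distrib)
qed

lemma lump_law:
  assumes "z 0 = pr w" "\<And>k. k < n \<Longrightarrow> 0 \<le> t k"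
  shows "(\<integral>\<^sup>+c. (\<integral>\<^sup>+e. (if seq_event n z t (lump_state pr N w c e) (lump_hold pr qW q N w c e) then 1 else 0) \<partial>noise q) \<partial>noise qW)
    = ennreal (path_prob q n z t)"
  using assms
proof (induction N arbitrary: n w z t)
  case 0
  interpret W: prob_space "noise qW" by (rule prob_space_noise)
  from 0 chain_law[OF finite_q, of z "pr w" n t] show ?case
    using W.emeasure_space_1 by simp
next
  case (Suc N)
  interpret Q: prob_space "noise q" by (rule prob_space_noise)
  interpret W: prob_space "noise qW" by (rule prob_space_noise)
  interpret E: prob_space "density lborel (exponential_density 1)" by (rule prob_space_exponential_noise)
  let ?E = "density lborel (exponential_density 1)"
  let ?ev = "\<lambda>N n z t w c e. seq_event n z t (lump_state pr N w c e) (lump_hold pr qW q N w c e)"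
  let ?F = "\<lambda>N n z t w. \<integral>\<^sup>+c. (\<integral>\<^sup>+e. (if ?ev N n z t w c e then 1 else 0) \<partial>noise q) \<partial>noise qW"
  show ?case
  proof (cases n)
    case 0
    with Suc.prems show ?thesis
      using W.emeasure_space_1 Q.emeasure_space_1 by (simp del: lump_state.simps)
  next
    case [simp]: (Suc n')
    let ?z = "\<lambda>i. z (Suc i)" and ?t = "\<lambda>i. t (Suc i)"
    define a where "a = total_rate qW w"
    define l where "l = total_rate q (pr w)"
    define R where "R = path_prob q n' ?z ?t"
    define p where "p = jump_prob q (pr w) (z (Suc 0))"
    have R: "0 \<le> R" and p: "0 \<le> p"
      using path_prob_nonneg[OF finite_q] jump_prob_nonneg[OF finite_q] by (simp_all add: R_def p_def)
    have t0: "0 \<le> t 0" using Suc.prems by simp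
    have goal: "path_prob q n z t = exp (- l * t 0) * p * R"
      using Suc.prems by (simp add: path_prob_Suc l_def p_def R_def)
    have la: "0 \<le> l" "l \<le> a"
      using total_rate_nonneg[OF finite_q] total_rate_le[of w] by (simp_all add: l_def a_def)
    have IH': "?F N n z (t(0 := s)) w' = ennreal (exp (- l * s) * p * R)" if "pr w' = pr w" "0 \<le> s" for w' s
    proof -
      have "?F N n z (t(0 := s)) w' = ennreal (path_prob q n z (t(0 := s)))"
        by (rule Suc.IH) (use Suc.prems that in auto)
      then show ?thesis
        using Suc.prems by (simp add: path_prob_Suc l_def p_def R_def)
    qed
    have IH1: "?F N n' ?z ?t w' = (if pr w' = z (Suc 0) then ennreal R else 0)" for w'
    proof (cases "pr w' = z (Suc 0)")
      case False
      then have "\<not> ?ev N n' ?z ?t w' c e" for c e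
        by (auto simp: seq_event_def intro!: exI[of _ 0])
      with False show ?thesis by simp
    qed (use Suc.IH[of ?z w' n' ?t] Suc.prems in \<open>simp add: R_def\<close>)
    define g where "g w' v = (if pr w' \<noteq> pr w
        then (if ennreal (t 0) \<le> hold qW w v then 1 else 0) * (if pr w' = z (Suc 0) then ennreal R else 0)
        else ennreal (exp (- l * enn2real (ennreal (t 0) - hold qW w v))) * ennreal (p * R))" for w' v
    have "?F (Suc N) n z t w = (\<integral>\<^sup>+a. (\<integral>\<^sup>+c. (\<integral>\<^sup>+e. (if ?ev (Suc N) n z t w (case_nat a c) e then 1 else 0) \<partial>noise q) \<partial>noise qW) \<partial>step_noise qW)"
    proof (rule nn_integral_noise)
      have "Measurable.pred (noise qW \<Otimes>\<^sub>M noise q) (\<lambda>p. ?ev (Suc N) n z t w (fst p) (snd p))"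
        by (intro measurable_seq_event measurable_lump_state measurable_lump_hold)
      then have "(\<lambda>p. if ?ev (Suc N) n z t w (fst p) (snd p) then 1 else 0 :: ennreal) \<in> borel_measurable (noise qW \<Otimes>\<^sub>M noise q)"
        by measurable
      from Q.borel_measurable_nn_integral_fst[OF this]
      show "(\<lambda>c. \<integral>\<^sup>+e. (if ?ev (Suc N) n z t w c e then 1 else 0) \<partial>noise q) \<in> borel_measurable (noise qW)"
        by simp
    qed
    also have "\<dots> = (\<integral>\<^sup>+a. g (snd a w) (fst a) \<partial>step_noise qW)"
    proof (rule nn_integral_cong)
      fix a :: "real \<times> ('w \<Rightarrow> 'w)"
      define w' where "w' = snd a w"
      define T where "T = hold qW w (fst a)"
      show "(\<integral>\<^sup>+c. (\<integral>\<^sup>+e. (if ?ev (Suc N) n z t w (case_nat a c) e then 1 else 0) \<partial>noise q) \<partial>noise qW) = g (snd a w) (fst a)"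
      proof (cases "pr w' = pr w")
        case False
        then have "?ev (Suc N) n z t w (case_nat a c) e \<longleftrightarrow> ennreal (t 0) \<le> T \<and> ?ev N n' ?z ?t w' c e" for c e
          using Suc.prems by (simp add: seq_event_Suc w'_def T_def)
        moreover have "g (snd a w) (fst a) = (if ennreal (t 0) \<le> T then 1 else 0) * (if pr w' = z (Suc 0) then ennreal R else 0)"
          using False by (simp add: g_def w'_def T_def)
        ultimately show ?thesis
          using IH1[of w'] by simp
      next
        case True
        define s where "s = enn2real (ennreal (t 0) - T)"
        have "ennreal (t 0) - T < top"
          by (simp add: diff_less_top_ennreal)
        then have s: "ennreal s = ennreal (t 0) - T" "0 \<le> s"
          by (auto simp: s_def)
        have le: "ennreal (t 0) \<le> T + x \<longleftrightarrow> ennreal s \<le> x" for x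
          unfolding s by (subst ennreal_minus_le_iff) auto
        have "?ev (Suc N) n z t w (case_nat a c) e \<longleftrightarrow> ?ev N n z (t(0 := s)) w' c e" for c e
          using True Suc.prems by (simp add: seq_event_Suc w'_def[symmetric] T_def[symmetric] le)
        moreover have "g (snd a w) (fst a) = ennreal (exp (- l * s) * p * R)"
          using True p R by (simp add: g_def w'_def[symmetric] T_def[symmetric] s_def[symmetric] ennreal_mult'[symmetric] mult.assoc)
        ultimately show ?thesis
          using IH'[OF True s(2)] by simp
      qed
    qed
    also have "\<dots> = (\<integral>\<^sup>+w'. (\<integral>\<^sup>+v. g w' v \<partial>?E) \<partial>jump_pmf qW w)"
      by (rule nn_integral_step_noise) (simp add: g_def)
    also have "\<dots> = ennreal (exp (- l * t 0) * p * R)"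
    proof (cases "a = 0")
      case True
      then have "l = 0" using la by simp
      have "(\<integral>\<^sup>+w'. (\<integral>\<^sup>+v. g w' v \<partial>?E) \<partial>jump_pmf qW w) = (\<integral>\<^sup>+w'. ennreal (p * R) \<partial>jump_pmf qW w)"
      proof (rule nn_integral_cong_AE, rule AE_pmfI)
        fix w' assume "w' \<in> set_pmf (jump_pmf qW w)"
        then have "w' = w"
          using True by (auto simp: set_jump_pmf[OF finite_qW] jump_prob_def a_def split: if_splits)
        with \<open>l = 0\<close> show "(\<integral>\<^sup>+v. g w' v \<partial>?E) = ennreal (p * R)"
          using E.emeasure_space_1 by (simp add: g_def)
      qed
      with \<open>l = 0\<close> show ?thesis by simp
    next
      case False
      with la have a: "a > 0" by simp
      define J where "J = (\<integral>\<^sup>+v. ennreal (exp (- l * max 0 (t 0 - v / a))) \<partial>?E)"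
      have AE_pos: "AE v in ?E. 0 \<le> v"
        by (subst AE_density) (auto simp: exponential_density_def)
      have J1: "(\<integral>\<^sup>+v. (if ennreal (t 0) \<le> hold qW w v then 1 else 0) \<partial>?E) = ennreal (exp (- a * t 0))"
      proof -
        have "(\<integral>\<^sup>+v. (if ennreal (t 0) \<le> hold qW w v then 1 else 0) \<partial>?E) = (\<integral>\<^sup>+v. indicator {a * t 0..} v \<partial>?E)"
          by (rule nn_integral_cong_AE) (use AE_pos in \<open>eventually_elim\<close>, 
            use a t0 in \<open>auto simp: hold_def a_def[symmetric] indicator_def field_simps\<close>)
        then show ?thesis
          using a t0 by (simp add: emeasure_exponential_noise_atLeast)
      qed
      have J2: "(\<integral>\<^sup>+v. ennreal (exp (- l * enn2real (ennreal (t 0) - hold qW w v))) \<partial>?E) = J"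
        unfolding J_def
      proof (rule nn_integral_cong_AE, use AE_pos in eventually_elim)
        case (elim v)
        have "enn2real (ennreal (t 0) - hold qW w v) = max 0 (t 0 - v / a)"
          using a t0 elim by (simp add: hold_def a_def[symmetric] ennreal_minus max_def ennreal_neg)
        then show ?case by simp
      qed
      let ?A = "{w'. pr w' = z (Suc 0) \<and> pr w' \<noteq> pr w}" and ?B = "{w'. pr w' \<noteq> pr w}"
      have "(\<integral>\<^sup>+w'. (\<integral>\<^sup>+v. g w' v \<partial>?E) \<partial>jump_pmf qW w)
        = (\<integral>\<^sup>+w'. ennreal (exp (- a * t 0)) * ennreal R * indicator ?A w' + J * ennreal (p * R) * indicator (- ?B) w' \<partial>jump_pmf qW w)"
        by (rule nn_integral_cong) (auto simp: g_def nn_integral_multc J1 J2[simplified] indicator_def)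
      also have "\<dots> = ennreal (exp (- a * t 0)) * ennreal R * emeasure (jump_pmf qW w) ?A + J * ennreal (p * R) * emeasure (jump_pmf qW w) (- ?B)"
        by (subst nn_integral_add) (auto simp: nn_integral_cmult_indicator)
      also have "emeasure (jump_pmf qW w) ?A = ennreal (l / a * p)"
      proof -
        have "measure_pmf.prob (jump_pmf qW w) ?A = (\<Sum>w' | qW w w' \<noteq> 0 \<and> w' \<in> ?A. qW w w') / a"
          unfolding a_def by (rule prob_jump_pmf) (use a in \<open>simp_all add: a_def\<close>)
        also have "\<dots> = l / a * p"
        proof (cases "z (Suc 0) = pr w")
          case True
          then have "(\<Sum>w' | qW w w' \<noteq> 0 \<and> w' \<in> ?A. qW w w') = 0"
            by (intro sum.neutral) auto
          moreover have "l * p = 0"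
            using True la by (auto simp: p_def jump_prob_def l_def)
          ultimately show ?thesis by simp
        next
          case False
          have "(\<Sum>w' | qW w w' \<noteq> 0 \<and> w' \<in> ?A. qW w w') = (\<Sum>w' | qW w w' \<noteq> 0 \<and> pr w' = z (Suc 0). qW w w')"
            using False by (intro sum.cong) auto
          also have "\<dots> = q (pr w) (z (Suc 0))"
            by (rule marginal[OF False])
          also have "\<dots> = l * p"
          proof (cases "l = 0")
            case True
            have "finite {z. q (pr w) z \<noteq> 0}" "\<And>z. 0 \<le> q (pr w) z"
              using finite_q by (auto simp: finite_rates_def)
            then have "q (pr w) (z (Suc 0)) \<le> l"
              unfolding l_def using False
              by (cases "q (pr w) (z (Suc 0)) = 0")
                 (auto simp: total_rate_eq_sum sum_nonneg intro!: member_le_sum[of "z (Suc 0)"] intro: rev_finite_subset)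
            moreover have "0 \<le> q (pr w) (z (Suc 0))"
              using finite_q by (simp add: finite_rates_def)
            ultimately show ?thesis using True by simp
          qed (use False la in \<open>simp add: p_def jump_prob_def l_def\<close>)
          finally show ?thesis by simp
        qed
        finally show ?thesis by (simp add: measure_pmf.emeasure_eq_measure)
      qed
      also have "emeasure (jump_pmf qW w) (- ?B) = ennreal (1 - l / a)"
      proof -
        have "measure_pmf.prob (jump_pmf qW w) ?B = l / a"
          using prob_jump_pmf[of w ?B] a by (simp add: a_def l_def sum_leaving_eq_total_rate)
        then show ?thesis
          using measure_pmf.prob_compl[of ?B "jump_pmf qW w"]
          by (simp add: measure_pmf.emeasure_eq_measure Compl_eq_Diff_UNIV)
      qed
      also have "ennreal (exp (- a * t 0)) * ennreal R * ennreal (l / a * p) + J * ennreal (p * R) * ennreal (1 - l / a)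
        = (ennreal (l / a) * ennreal (exp (- a * t 0)) + ennreal (1 - l / a) * J) * ennreal (p * R)"
        using a la p R unfolding ennreal_mult[OF divide_nonneg_pos[OF la(1) a] p] ennreal_mult[OF p R]
        by (simp add: distrib_left distrib_right ac_simps)
      also have "ennreal (l / a) * ennreal (exp (- a * t 0)) + ennreal (1 - l / a) * J = ennreal (exp (- l * t 0))"
        unfolding J_def by (rule nn_integral_exponential_noise_residual[OF a la t0])
      finally show ?thesis
        using p R by (simp add: ennreal_mult'[symmetric] mult.assoc)
    qed
    finally show ?thesis
      unfolding goal .
  qed
qed

end

lemma lump_without_jumps:
  assumes "\<And>i. i < N \<Longrightarrow> pr (chain_state (Suc i) w c) = pr (chain_state i w c)"
  shows "lump_state pr N w c e k = chain_state k (pr w) e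
    \<and> lump_hold pr qW q N w c e k
      = (if k = 0 then \<Sum>i<N. chain_hold qW i w c else 0) + chain_hold q k (pr w) e"
  using assms
proof (induction N arbitrary: w c)
  case (Suc N)
  let ?w = "snd (c 0) w" and ?c = "\<lambda>i. c (Suc i)"
  have pr: "pr ?w = pr w"
    using Suc.prems[of 0] by simp
  have "pr (chain_state (Suc i) ?w ?c) = pr (chain_state i ?w ?c)" if "i < N" for i
    using Suc.prems[of "Suc i"] that by simp
  from Suc.IH[OF this] pr show ?case
    by (simp add: sum.lessThan_Suc_shift add.assoc del: sum.lessThan_Suc)
qed simp

lemma lump_after_jump:
  assumes "\<And>i. i < m \<Longrightarrow> pr (chain_state (Suc i) w c) = pr (chain_state i w c)"
    and "pr (chain_state (Suc m) w c) \<noteq> pr (chain_state m w c)"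
  shows "\<exists>w' c' s. \<forall>N. lump_hold pr qW q (N + Suc m) w c e 0 = s
    \<and> (\<forall>k. lump_state pr (N + Suc m) w c e (Suc k) = lump_state pr N w' c' e k)
    \<and> (\<forall>k. lump_hold pr qW q (N + Suc m) w c e (Suc k) = lump_hold pr qW q N w' c' e k)"
  using assms
proof (induction m arbitrary: w c)
  case 0
  then show ?case
    by (auto intro!: exI[of _ "snd (c 0) w"] exI[of _ "\<lambda>i. c (Suc i)"])
next
  case (Suc m)
  let ?w = "snd (c 0) w" and ?c = "\<lambda>i. c (Suc i)"
  have pr: "pr ?w = pr w"
    using Suc.prems(1)[of 0] by simp
  obtain w' c' s where *: "\<forall>N. lump_hold pr qW q (N + Suc m) ?w ?c e 0 = s
    \<and> (\<forall>k. lump_state pr (N + Suc m) ?w ?c e (Suc k) = lump_state pr N w' c' e k)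
    \<and> (\<forall>k. lump_hold pr qW q (N + Suc m) ?w ?c e (Suc k) = lump_hold pr qW q N w' c' e k)"
    using Suc.IH[of ?w ?c] Suc.prems(1)[of "Suc _"] Suc.prems(2) by auto
  have shift: "lump_state pr (N + Suc (Suc m)) w c e k = lump_state pr (N + Suc m) ?w ?c e k"
    "lump_hold pr qW q (N + Suc (Suc m)) w c e k = 
      (if k = 0 then hold qW w (fst (c 0)) else 0) + lump_hold pr qW q (N + Suc m) ?w ?c e k" for N k
    unfolding add_Suc_right[of N "Suc m"] lump_state.simps lump_hold.simps using pr by auto
  show ?case
    using * by (intro exI[of _ w'] exI[of _ c'] exI[of _ "hold qW w (fst (c 0)) + s"]) (simp only: shift, simp)
qed

lemma lump_converges:
  "(\<exists>v. \<forall>\<^sub>F N in sequentially. lump_state pr N w c e k = v)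
    \<and> (\<exists>s. (\<lambda>N. lump_hold pr qW q N w c e k) \<longlonglongrightarrow> s)"
proof (induction k arbitrary: w c rule: less_induct)
  case (less k)
  note lump_state.simps [simp del] lump_hold.simps [simp del]
  show ?case
  proof (cases "\<exists>m. pr (chain_state (Suc m) w c) \<noteq> pr (chain_state m w c)")
    case True
    then obtain m where "pr (chain_state (Suc m) w c) \<noteq> pr (chain_state m w c)"
      and "\<And>i. i < m \<Longrightarrow> pr (chain_state (Suc i) w c) = pr (chain_state i w c)"
      using exists_least_iff[of "\<lambda>m. pr (chain_state (Suc m) w c) \<noteq> pr (chain_state m w c)"] by blast
    then obtain w' c' s where *: "\<And>N. lump_hold pr qW q (N + Suc m) w c e 0 = s"
      "\<And>N k. lump_state pr (N + Suc m) w c e (Suc k) = lump_state pr N w' c' e k"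
      "\<And>N k. lump_hold pr qW q (N + Suc m) w c e (Suc k) = lump_hold pr qW q N w' c' e k"
      using lump_after_jump[of m pr w c qW q e] by blast
    show ?thesis
    proof (cases k)
      case 0
      have "(\<lambda>N. lump_hold pr qW q (N + Suc m) w c e 0) \<longlonglongrightarrow> s"
        unfolding * by (rule tendsto_const)
      then have "(\<lambda>N. lump_hold pr qW q N w c e 0) \<longlonglongrightarrow> s"
        by (rule LIMSEQ_offset)
      with 0 show ?thesis
        by auto
    next
      case (Suc k')
      obtain v s where "\<forall>\<^sub>F N in sequentially. lump_state pr N w' c' e k' = v"
        "(\<lambda>N. lump_hold pr qW q N w' c' e k') \<longlonglongrightarrow> s"
        using less.IH[of k' w' c'] Suc by auto
      then have ev: "\<forall>\<^sub>F N in sequentially. lump_state pr (N + Suc m) w c e k = v"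
        and li: "(\<lambda>N. lump_hold pr qW q (N + Suc m) w c e k) \<longlonglongrightarrow> s"
        by (simp_all only: Suc *)
      from ev have "\<forall>\<^sub>F N in sequentially. lump_state pr N w c e k = v"
        by (subst (asm) eventually_sequentially_seg)
      moreover from li have "(\<lambda>N. lump_hold pr qW q N w c e k) \<longlonglongrightarrow> s"
        by (rule LIMSEQ_offset)
      ultimately show ?thesis by blast
    qed
  next
    case False
    then have "lump_state pr N w c e k = chain_state k (pr w) e"
      "lump_hold pr qW q N w c e k
        = (if k = 0 then \<Sum>i<N. chain_hold qW i w c else 0) + chain_hold q k (pr w) e" for N
      using lump_without_jumps[of N pr w c] by blast+
    moreover have "(\<lambda>N. (if k = 0 then \<Sum>i<N. chain_hold qW i w c else 0) + chain_hold q k (pr w) e)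
      \<longlonglongrightarrow> (if k = 0 then \<Sum>i. chain_hold qW i w c else 0) + chain_hold q k (pr w) e"
      by (cases "k = 0") (auto intro!: tendsto_add summable_LIMSEQ)
    ultimately show ?thesis by auto
  qed
qed

definition lump_state_lim :: "('w \<Rightarrow> 's) \<Rightarrow> 'w \<Rightarrow> (nat \<Rightarrow> real \<times> ('w \<Rightarrow> 'w)) \<Rightarrow> (nat \<Rightarrow> real \<times> ('s \<Rightarrow> 's)) \<Rightarrow> nat \<Rightarrow> 's" where
  "lump_state_lim pr w c e k = (THE v. \<forall>\<^sub>F N in sequentially. lump_state pr N w c e k = v)"

definition lump_hold_lim :: "('w \<Rightarrow> 's) \<Rightarrow> ('w \<Rightarrow> 'w \<Rightarrow> real) \<Rightarrow> ('s \<Rightarrow> 's \<Rightarrow> real) \<Rightarrow> 'w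
    \<Rightarrow> (nat \<Rightarrow> real \<times> ('w \<Rightarrow> 'w)) \<Rightarrow> (nat \<Rightarrow> real \<times> ('s \<Rightarrow> 's)) \<Rightarrow> nat \<Rightarrow> ennreal" where
  "lump_hold_lim pr qW q w c e k = liminf (\<lambda>N. lump_hold pr qW q N w c e k)"

lemma lump_state_lim_eqI:
  assumes "\<forall>\<^sub>F N in sequentially. lump_state pr N w c e k = v"
  shows "lump_state_lim pr w c e k = v"
  unfolding lump_state_lim_def
proof (rule the_equality)
  fix v' assume "\<forall>\<^sub>F N in sequentially. lump_state pr N w c e k = v'"
  with assms have "\<forall>\<^sub>F N::nat in sequentially. v' = v"
    by eventually_elim simp
  then show "v' = v" by simp
qed fact

lemma lump_state_lim_iff:
  "lump_state_lim pr w c e k = v \<longleftrightarrow> (\<forall>\<^sub>F N in sequentially. lump_state pr N w c e k = v)"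
  using lump_converges[of pr w c e k] lump_state_lim_eqI[of pr w c e k] by auto

lemma lump_state_lim_0 [simp]: "lump_state_lim pr w c e 0 = pr w"
  by (simp add: lump_state_lim_iff)

lemma lump_hold_lim_eqI:
  "(\<lambda>N. lump_hold pr qW q N w c e k) \<longlonglongrightarrow> s \<Longrightarrow> lump_hold_lim pr qW q w c e k = s"
  unfolding lump_hold_lim_def by (rule lim_imp_Liminf) simp_all

lemma tendsto_lump_hold_lim: "(\<lambda>N. lump_hold pr qW q N w c e k) \<longlonglongrightarrow> lump_hold_lim pr qW q w c e k"
  using lump_converges[of pr w c e k qW q] lump_hold_lim_eqI[of pr qW q w c e k] by auto

lemma lump_state_lim_rec:
  "lump_state_lim pr w c e k =
    (if pr (snd (c 0) w) \<noteq> pr w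
     then case k of 0 \<Rightarrow> pr w | Suc k' \<Rightarrow> lump_state_lim pr (snd (c 0) w) (\<lambda>i. c (Suc i)) e k'
     else lump_state_lim pr (snd (c 0) w) (\<lambda>i. c (Suc i)) e k)"
proof (rule lump_state_lim_eqI)
  have "\<forall>\<^sub>F N in sequentially. lump_state pr N w c e k = lump_state_lim pr w c e k" for w c k
    using lump_state_lim_iff[of pr w c e k "lump_state_lim pr w c e k"] by simp
  then have "\<forall>\<^sub>F N in sequentially. lump_state pr (Suc N) w c e k =
    (if pr (snd (c 0) w) \<noteq> pr w
     then case k of 0 \<Rightarrow> pr w | Suc k' \<Rightarrow> lump_state_lim pr (snd (c 0) w) (\<lambda>i. c (Suc i)) e k'
     else lump_state_lim pr (snd (c 0) w) (\<lambda>i. c (Suc i)) e k)"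
    by (cases k) (auto simp del: lump_state_0 lump_state_lim_0)
  then show "\<forall>\<^sub>F N in sequentially. lump_state pr N w c e k =
    (if pr (snd (c 0) w) \<noteq> pr w
     then case k of 0 \<Rightarrow> pr w | Suc k' \<Rightarrow> lump_state_lim pr (snd (c 0) w) (\<lambda>i. c (Suc i)) e k'
     else lump_state_lim pr (snd (c 0) w) (\<lambda>i. c (Suc i)) e k)"
    by (subst (asm) eventually_sequentially_Suc)
qed

lemma lump_hold_lim_rec:
  "lump_hold_lim pr qW q w c e k =
    (if pr (snd (c 0) w) \<noteq> pr w
     then case k of 0 \<Rightarrow> hold qW w (fst (c 0)) | Suc k' \<Rightarrow> lump_hold_lim pr qW q (snd (c 0) w) (\<lambda>i. c (Suc i)) e k'
     else (if k = 0 then hold qW w (fst (c 0)) else 0) + lump_hold_lim pr qW q (snd (c 0) w) (\<lambda>i. c (Suc i)) e k)"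
  by (rule lump_hold_lim_eqI, rule LIMSEQ_imp_Suc, cases k)
    (auto intro!: tendsto_lump_hold_lim tendsto_add)

lemma measurable_lump_state_lim [measurable]:
  fixes pr :: "'w::countable \<Rightarrow> 's::countable"
  shows "(\<lambda>p. lump_state_lim pr w (fst p) (snd p) k) \<in> noise qW \<Otimes>\<^sub>M noise q \<rightarrow>\<^sub>M count_space UNIV"
proof (subst measurable_count_space_eq_countable)
  note [measurable] = measurable_lump_state
  have "(\<lambda>p. lump_state_lim pr w (fst p) (snd p) k) -` {a} \<inter> space (noise qW \<Otimes>\<^sub>M noise q)
    = {p \<in> space (noise qW \<Otimes>\<^sub>M noise q). \<exists>N0. \<forall>N\<ge>N0. lump_state pr N w (fst p) (snd p) k = a}" for a
    unfolding vimage_def Int_def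
    by (simp add: lump_state_lim_iff eventually_sequentially conj_commute)
  also have "\<dots> a \<in> sets (noise qW \<Otimes>\<^sub>M noise q)" for a
    by measurable
  finally show "(\<lambda>p. lump_state_lim pr w (fst p) (snd p) k) \<in> space (noise qW \<Otimes>\<^sub>M noise q) \<rightarrow> UNIV \<and>
    (\<forall>a\<in>UNIV. (\<lambda>p. lump_state_lim pr w (fst p) (snd p) k) -` {a} \<inter> space (noise qW \<Otimes>\<^sub>M noise q) \<in> sets (noise qW \<Otimes>\<^sub>M noise q))"
    by simp
qed simp

lemma measurable_lump_hold_lim [measurable]:
  "(\<lambda>p. lump_hold_lim pr qW q w (fst p) (snd p) k) \<in> borel_measurable (noise qW' \<Otimes>\<^sub>M noise q')"
  unfolding lump_hold_lim_def by (intro borel_measurable_liminf measurable_lump_hold)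

lemma lump_path:
  assumes "(\<Sum>i<m. chain_hold qW i w c) \<le> t" "t < (\<Sum>i<Suc m. chain_hold qW i w c)"
  shows "\<exists>n. lump_state_lim pr w c e n = pr (chain_state m w c)
    \<and> (\<Sum>k<n. lump_hold_lim pr qW q w c e k) \<le> t \<and> t < (\<Sum>k<Suc n. lump_hold_lim pr qW q w c e k)"
  using assms
proof (induction m arbitrary: w c t)
  case 0
  have "t < lump_hold_lim pr qW q w c e 0"
    using 0 by (subst lump_hold_lim_rec) (auto intro: order.strict_trans2)
  then show ?case
    by (intro exI[of _ 0]) simp
next
  case (Suc m)
  let ?w = "snd (c 0) w" and ?c = "\<lambda>i. c (Suc i)"
  let ?T = "hold qW w (fst (c 0))"
  let ?S = "lump_hold_lim pr qW q w c e" and ?S' = "lump_hold_lim pr qW q ?w ?c e"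
  have ge: "?T + (\<Sum>i<m. chain_hold qW i ?w ?c) \<le> t" and less: "t < ?T + (\<Sum>i<Suc m. chain_hold qW i ?w ?c)"
    using Suc.prems by (simp_all add: sum.lessThan_Suc_shift del: sum.lessThan_Suc)
  have "?T \<le> t" using ge by (rule order.trans[rotated]) simp
  moreover have "t < top" using less by (rule order.strict_trans2) simp
  ultimately have T: "?T < top" and t: "t = ?T + (t - ?T)"
    by (auto simp: ennreal_add_diff_cancel add_diff_inverse_ennreal)
  obtain n where n: "lump_state_lim pr ?w ?c e n = pr (chain_state m ?w ?c)"
    "(\<Sum>k<n. ?S' k) \<le> t - ?T" "t - ?T < (\<Sum>k<Suc n. ?S' k)"
    using Suc.IH[of ?w ?c "t - ?T"] ge less T t
    by (metis (no_types, lifting) ennreal_add_left_cancel_le ennreal_add_left_cancel_less)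
  have "?T + (\<Sum>k<n. ?S' k) \<le> ?T + (t - ?T)"
    using n(2) by (rule add_left_mono)
  then have ge': "?T + (\<Sum>k<n. ?S' k) \<le> t"
    using t by simp
  have "?T + (t - ?T) < ?T + (\<Sum>k<Suc n. ?S' k)"
    using n(3) T by (simp only: ennreal_add_left_cancel_less) simp
  then have less': "t < ?T + (\<Sum>k<Suc n. ?S' k)"
    using t by simp
  show ?case
  proof (cases "pr ?w = pr w")
    case False
    then have "lump_state_lim pr w c e (Suc n) = pr (chain_state (Suc m) w c)"
      "?S 0 = ?T" "?S (Suc k) = ?S' k" for k
      using n(1) by (simp_all add: lump_state_lim_rec[of pr w c] lump_hold_lim_rec[of pr qW q w c])
    with ge' less' show ?thesis
      by (intro exI[of _ "Suc n"]) (simp add: sum.lessThan_Suc_shift del: sum.lessThan_Suc)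
  next
    case True
    then have Z: "lump_state_lim pr w c e n = pr (chain_state (Suc m) w c)"
      and S0: "?S 0 = ?T + ?S' 0" and SS: "?S (Suc k) = ?S' (Suc k)" for k
      using n(1) by (simp_all add: lump_state_lim_rec[of pr w c] lump_hold_lim_rec[of pr qW q w c])
    have sum: "(\<Sum>k<Suc n. ?S k) = ?T + (\<Sum>k<Suc n. ?S' k)" for n
      by (simp add: sum.lessThan_Suc_shift S0 SS add.assoc del: sum.lessThan_Suc)
    have "(\<Sum>k<n. ?S k) \<le> t"
      using ge' by (cases n) (simp_all only: sum, simp)
    with Z less' show ?thesis
      unfolding sum[symmetric] by blast
  qed
qed

lemma lump_hold_sum_le:
  assumes "n \<le> (\<Sum>i<m. if pr (chain_state (Suc i) w c) \<noteq> pr (chain_state i w c) then 1 else 0)"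
  shows "(\<Sum>k<n. lump_hold_lim pr qW q w c e k) \<le> (\<Sum>i<m. chain_hold qW i w c)"
  using assms
proof (induction m arbitrary: w c n)
  case (Suc m)
  let ?w = "snd (c 0) w" and ?c = "\<lambda>i. c (Suc i)"
  let ?S = "lump_hold_lim pr qW q w c e" and ?S' = "lump_hold_lim pr qW q ?w ?c e"
  let ?T = "hold qW w (fst (c 0))"
  have n: "n \<le> (if pr ?w \<noteq> pr w then 1 else 0) + (\<Sum>i<m. if pr (chain_state (Suc i) ?w ?c) \<noteq> pr (chain_state i ?w ?c) then 1 else 0)"
    using Suc.prems by (simp add: sum.lessThan_Suc_shift del: sum.lessThan_Suc)
  show ?case
  proof (cases n)
    case [simp]: (Suc n')
    have "(\<Sum>k<n. ?S k) \<le> ?T + (\<Sum>i<m. chain_hold qW i ?w ?c)"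
    proof (cases "pr ?w = pr w")
      case True
      then have "(\<Sum>k<n. ?S k) = ?T + (\<Sum>k<n. ?S' k)"
        by (simp add: sum.lessThan_Suc_shift lump_hold_lim_rec[of pr qW q w c] add.assoc del: sum.lessThan_Suc)
      with True n Suc.IH[of n ?w ?c] show ?thesis by (simp add: add_left_mono)
    next
      case False
      then have "(\<Sum>k<n. ?S k) = ?T + (\<Sum>k<n'. ?S' k)"
        by (simp add: sum.lessThan_Suc_shift lump_hold_lim_rec[of pr qW q w c] del: sum.lessThan_Suc)
      with False n Suc.IH[of n' ?w ?c] show ?thesis by (simp add: add_left_mono)
    qed
    then show ?thesis
      by (simp add: sum.lessThan_Suc_shift del: sum.lessThan_Suc)
  qed simp
qed simp

lemma (in prob_space) prob_le_of_eventually: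
  assumes [measurable]: "\<And>N::nat. A N \<in> events"
    and ev: "\<And>x. x \<in> B \<Longrightarrow> \<forall>\<^sub>F N in sequentially. x \<in> A N"
    and le: "\<And>N. prob (A N) \<le> g"
  shows "prob B \<le> g"
proof -
  define C where "C N = (\<Inter>m\<in>{N..}. A m)" for N
  have [measurable]: "C N \<in> events" for N
    unfolding C_def by (intro sets.countable_INT) auto
  have "incseq C"
    unfolding C_def incseq_def by (auto intro: order.trans)
  then have lim: "(\<lambda>N. prob (C N)) \<longlonglongrightarrow> prob (\<Union>N. C N)"
    by (intro finite_Lim_measure_incseq) auto
  have "prob (C N) \<le> prob (A N)" for N
    by (intro finite_measure_mono) (auto simp: C_def)
  then have "prob (\<Union>N. C N) \<le> g"
    using le by (intro LIMSEQ_le_const2[OF lim]) (auto intro: order.trans)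
  moreover have "B \<subseteq> (\<Union>N. C N)"
    using ev by (auto simp: C_def eventually_sequentially) blast
  then have "prob B \<le> prob (\<Union>N. C N)"
    by (intro finite_measure_mono) auto
  ultimately show ?thesis by simp
qed

definition ctmc_law :: "'w measure \<Rightarrow> ('s \<Rightarrow> 's \<Rightarrow> real) \<Rightarrow> 's \<Rightarrow> ('w \<Rightarrow> nat \<Rightarrow> 's) \<Rightarrow> ('w \<Rightarrow> nat \<Rightarrow> ennreal) \<Rightarrow> bool" where
  "ctmc_law P q x0 Z S \<longleftrightarrow>
    (\<forall>n. (\<lambda>\<omega>. Z \<omega> n) \<in> P \<rightarrow>\<^sub>M count_space UNIV) \<and> (\<forall>n. (\<lambda>\<omega>. S \<omega> n) \<in> borel_measurable P) \<and>
    (\<forall>n z t. z 0 = x0 \<longrightarrow> (\<forall>k<n. 0 \<le> t k) \<longrightarrow>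
      measure P {\<omega> \<in> space P. (\<forall>k\<le>n. Z \<omega> k = z k) \<and> (\<forall>k<n. ennreal (t k) < S \<omega> k)} = path_prob q n z t)"

lemma (in lumping) lump_law_lim:
  "ctmc_law (noise qW \<Otimes>\<^sub>M noise q) q (pr w)
    (\<lambda>p. lump_state_lim pr w (fst p) (snd p)) (\<lambda>p. lump_hold_lim pr qW q w (fst p) (snd p))"
  unfolding ctmc_law_def
proof (intro conjI allI impI)
  fix n :: nat and z :: "nat \<Rightarrow> 's" and t :: "nat \<Rightarrow> real"
  assume z: "z 0 = pr w" and t: "\<forall>k<n. 0 \<le> t k"
  interpret Q: prob_space "noise q" by (rule prob_space_noise)
  interpret W: prob_space "noise qW" by (rule prob_space_noise)
  interpret P: pair_prob_space "noise qW" "noise q" ..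
  let ?P = "noise qW \<Otimes>\<^sub>M noise q"
  let ?Z = "\<lambda>p. lump_state_lim pr w (fst p) (snd p)" and ?S = "\<lambda>p. lump_hold_lim pr qW q w (fst p) (snd p)"
  let ?ZN = "\<lambda>N p. lump_state pr N w (fst p) (snd p)" and ?SN = "\<lambda>N p. lump_hold pr qW q N w (fst p) (snd p)"
  define AN where "AN N t = {p \<in> space ?P. seq_event n z t (?ZN N p) (?SN N p)}" for N t
  define A where "A t = {p \<in> space ?P. seq_event n z t (?Z p) (?S p)}" for t
  define B where "B = {p \<in> space ?P. (\<forall>k\<le>n. ?Z p k = z k) \<and> (\<forall>k<n. ennreal (t k) < ?S p k)}"
  have [measurable]: "AN N t \<in> sets ?P" for N t
    unfolding AN_def by (intro predE measurable_seq_event measurable_lump_state measurable_lump_hold)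
  have [measurable]: "A t \<in> sets ?P" for t
    unfolding A_def by (intro predE measurable_seq_event measurable_lump_state_lim measurable_lump_hold_lim)
  have [measurable]: "B \<in> sets ?P"
    unfolding B_def by measurable
  have prob_AN: "P.prob (AN N t) = path_prob q n z t" if "\<And>k. k < n \<Longrightarrow> 0 \<le> t k" for N t
  proof -
    have "emeasure ?P (AN N t) = (\<integral>\<^sup>+p. indicator (AN N t) p \<partial>?P)"
      by simp
    also have "\<dots> = (\<integral>\<^sup>+c. \<integral>\<^sup>+e. indicator (AN N t) (c, e) \<partial>noise q \<partial>noise qW)"
      by (rule Q.nn_integral_fst[symmetric]) measurable
    also have "\<dots> = (\<integral>\<^sup>+c. (\<integral>\<^sup>+e. (if seq_event n z t (lump_state pr N w c e) (lump_hold pr qW q N w c e) then 1 else 0) \<partial>noise q) \<partial>noise qW)"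
      by (intro nn_integral_cong) (simp add: AN_def indicator_def space_pair_measure)
    also have "\<dots> = ennreal (path_prob q n z t)"
      using z that by (rule lump_law)
    finally show ?thesis
      using path_prob_nonneg[OF finite_q] by (simp add: P.emeasure_eq_measure)
  qed
  have ev_Z: "\<forall>\<^sub>F N in sequentially. ?ZN N p k = ?Z p k" for p k
    using lump_state_lim_iff[of pr w "fst p" "snd p" k "?Z p k"] by simp
  have lim_S: "(\<lambda>N. ?SN N p k) \<longlonglongrightarrow> ?S p k" for p k
    by (rule tendsto_lump_hold_lim)
  have upper: "P.prob B \<le> path_prob q n z t"
  proof (rule P.prob_le_of_eventually[where A="\<lambda>N. AN N t"])
    fix p assume p: "p \<in> B"
    have "\<forall>\<^sub>F N in sequentially. \<forall>k\<in>{..n}. ?ZN N p k = z k"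
    proof (intro eventually_ball_finite ballI)
      fix k assume "k \<in> {..n}"
      with p have "?Z p k = z k" by (simp add: B_def)
      with ev_Z[of p k] show "\<forall>\<^sub>F N in sequentially. ?ZN N p k = z k" by simp
    qed simp
    moreover have "\<forall>\<^sub>F N in sequentially. \<forall>k\<in>{..<n}. ennreal (t k) < ?SN N p k"
      using p by (intro eventually_ball_finite ballI order_tendstoD(1)[OF lim_S]) (auto simp: B_def)
    ultimately show "\<forall>\<^sub>F N in sequentially. p \<in> AN N t"
      by eventually_elim (use p in \<open>auto simp: AN_def B_def seq_event_def intro: less_imp_le\<close>)
  qed (use prob_AN t in auto)
  have lower: "path_prob q n z s \<le> P.prob (A s)" if s: "\<And>k. k < n \<Longrightarrow> 0 \<le> s k" for s
  proof -
    have "P.prob (space ?P - A s) \<le> 1 - path_prob q n z s"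
    proof (rule P.prob_le_of_eventually[where A="\<lambda>N. space ?P - AN N s"])
      fix p assume p: "p \<in> space ?P - A s"
      then consider k where "k \<le> n" "?Z p k \<noteq> z k" | k where "k < n" "?S p k < ennreal (s k)"
        by (auto simp: A_def seq_event_def not_le)
      then show "\<forall>\<^sub>F N in sequentially. p \<in> space ?P - AN N s"
      proof cases
        case 1
        show ?thesis
          using ev_Z[of p k] by eventually_elim (use 1 p in \<open>auto simp: AN_def seq_event_def\<close>)
      next
        case 2
        show ?thesis
          using order_tendstoD(2)[OF lim_S 2(2)]
          by eventually_elim (use 2 p in \<open>auto simp: AN_def seq_event_def not_le\<close>)
      qed
    qed (use prob_AN[OF s] P.prob_compl in auto)
    then show ?thesis
      using P.prob_compl[of "A s"] by simp
  qed
  have "path_prob q n z (\<lambda>k. t k + inverse (real (Suc m))) \<le> P.prob B" for m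
  proof -
    have "path_prob q n z (\<lambda>k. t k + inverse (real (Suc m))) \<le> P.prob (A (\<lambda>k. t k + inverse (real (Suc m))))"
      using t by (intro lower) auto
    also have "\<dots> \<le> P.prob B"
    proof (rule P.finite_measure_mono)
      have "ennreal (t k) < ennreal (t k + inverse (real (Suc m)))" if "k < n" for k
        using t that by (intro ennreal_lessI) (auto intro: add_nonneg_pos)
      then show "A (\<lambda>k. t k + inverse (real (Suc m))) \<subseteq> B"
        by (auto simp: A_def B_def seq_event_def intro: order.strict_trans2)
    qed simp
    finally show ?thesis .
  qed
  moreover have "(\<lambda>m. path_prob q n z (\<lambda>k. t k + inverse (real (Suc m)))) \<longlonglongrightarrow> path_prob q n z (\<lambda>k. t k + 0)"
    unfolding path_prob_def by (intro tendsto_intros LIMSEQ_inverse_real_of_nat)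
  ultimately have "path_prob q n z t \<le> P.prob B"
    by (intro LIMSEQ_le_const2[where X="\<lambda>m. path_prob q n z (\<lambda>k. t k + inverse (real (Suc m)))"]) auto
  with upper show "P.prob B = path_prob q n z t"
    by simp
qed measurable

lemma ctmc_law_distr:
  assumes "ctmc_law M q x0 Z S" and f [measurable]: "f \<in> P \<rightarrow>\<^sub>M M" and M: "distr P M f = M"
  shows "ctmc_law P q x0 (\<lambda>\<omega>. Z (f \<omega>)) (\<lambda>\<omega>. S (f \<omega>))"
  unfolding ctmc_law_def
proof (intro conjI allI impI)
  have [measurable]: "(\<lambda>\<omega>. Z \<omega> n) \<in> M \<rightarrow>\<^sub>M count_space UNIV" "(\<lambda>\<omega>. S \<omega> n) \<in> borel_measurable M" for n
    using assms(1) by (auto simp: ctmc_law_def)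
  show "(\<lambda>\<omega>. Z (f \<omega>) n) \<in> P \<rightarrow>\<^sub>M count_space UNIV" "(\<lambda>\<omega>. S (f \<omega>) n) \<in> borel_measurable P" for n
    by measurable
  fix n :: nat and z :: "nat \<Rightarrow> 'b" and t :: "nat \<Rightarrow> real"
  assume *: "z 0 = x0" "\<forall>k<n. 0 \<le> t k"
  let ?A = "{\<omega> \<in> space M. (\<forall>k\<le>n. Z \<omega> k = z k) \<and> (\<forall>k<n. ennreal (t k) < S \<omega> k)}"
  have "measure (distr P M f) ?A = measure P (f -` ?A \<inter> space P)"
    by (rule measure_distr) measurable
  moreover have "f -` ?A \<inter> space P = {\<omega> \<in> space P. (\<forall>k\<le>n. Z (f \<omega>) k = z k) \<and> (\<forall>k<n. ennreal (t k) < S (f \<omega>) k)}"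
    using measurable_space[OF f] by auto
  moreover have "measure M ?A = path_prob q n z t"
    using assms(1) * by (auto simp: ctmc_law_def)
  ultimately show "measure P {\<omega> \<in> space P. (\<forall>k\<le>n. Z (f \<omega>) k = z k) \<and> (\<forall>k<n. ennreal (t k) < S (f \<omega>) k)} = path_prob q n z t"
    using M by simp
qed

definition alive :: "(nat \<Rightarrow> ennreal) \<Rightarrow> ennreal \<Rightarrow> bool" where
  "alive S t \<longleftrightarrow> (\<exists>n. t < (\<Sum>k<Suc n. S k))"

definition path_at :: "(nat \<Rightarrow> 's) \<Rightarrow> (nat \<Rightarrow> ennreal) \<Rightarrow> ennreal \<Rightarrow> 's" where
  "path_at Z S t = Z (LEAST n. t < (\<Sum>k<Suc n. S k))"

lemma path_at_eq:
  assumes "(\<Sum>k<n. S k) \<le> t" "t < (\<Sum>k<Suc n. S k)"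
  shows "path_at Z S t = Z n"
  unfolding path_at_def
proof (rule arg_cong[where f=Z], rule Least_equality)
  fix m assume m: "t < (\<Sum>k<Suc m. S k)"
  show "n \<le> m"
  proof (rule ccontr)
    assume "\<not> n \<le> m"
    then have "(\<Sum>k<Suc m. S k) \<le> (\<Sum>k<n. S k)"
      by (intro sum_mono2) auto
    with m assms show False by simp
  qed
qed fact

lemma is_ctmcI:
  assumes "ctmc_law P q x0 Z S"
    and "\<And>\<omega> t. \<omega> \<in> space P \<Longrightarrow> 0 \<le> t \<Longrightarrow> alive (S \<omega>) (ennreal t) \<Longrightarrow> X t \<omega> = path_at (Z \<omega>) (S \<omega>) (ennreal t)"
  shows "is_ctmc P q x0 X"
  unfolding is_ctmc_def
proof (intro exI[of _ "\<lambda>n \<omega>. Z \<omega> n"] exI[of _ "\<lambda>n \<omega>. S \<omega> n"] conjI ballI allI impI)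
  fix \<omega> n and t :: real
  assume "\<omega> \<in> space P" "0 \<le> t" "(\<Sum>k<n. S \<omega> k) \<le> ennreal t" "ennreal t < (\<Sum>k<Suc n. S \<omega> k)"
  then show "X t \<omega> = Z \<omega> n"
    using assms(2)[of \<omega> t] path_at_eq[where S="S \<omega>" and Z="Z \<omega>"] by (auto simp: alive_def)
qed (use assms(1) in \<open>auto simp: ctmc_law_def path_prob_def\<close>)

definition sequence_embeddable :: "'a measure \<Rightarrow> bool" where
  "sequence_embeddable M \<longleftrightarrow> (\<exists>f g. f \<in> M \<rightarrow>\<^sub>M PiM (UNIV :: nat set) (\<lambda>_. borel :: real measure)
    \<and> g \<in> PiM UNIV (\<lambda>_. borel) \<rightarrow>\<^sub>M M \<and> (\<forall>x\<in>space M. g (f x) = x))"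

lemma sequence_embeddable_cong:
  "sets M = sets N \<Longrightarrow> sequence_embeddable M \<longleftrightarrow> sequence_embeddable N"
  unfolding sequence_embeddable_def
  by (simp only: measurable_cong_sets[of M N] measurable_cong_sets[of _ _ M N] sets_eq_imp_space_eq[of M N] refl)

lemma sequence_embeddable_borel: "sequence_embeddable (borel :: real measure)"
  unfolding sequence_embeddable_def
  by (intro exI[of _ "\<lambda>x _. x"] exI[of _ "\<lambda>\<omega>. \<omega> 0"] conjI measurable_PiM_single') auto

lemma sequence_embeddable_count_space: "sequence_embeddable (count_space (UNIV :: 'a::countable set))"
  unfolding sequence_embeddable_def
proof (intro exI[of _ "\<lambda>x _. real (to_nat x)"] exI[of _ "\<lambda>\<omega>. from_nat (nat \<lfloor>\<omega> 0\<rfloor>)"] conjI)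
  have "(\<lambda>\<omega>. nat \<lfloor>\<omega> 0 :: real\<rfloor>) \<in> PiM (UNIV :: nat set) (\<lambda>_. borel) \<rightarrow>\<^sub>M count_space UNIV"
    by measurable
  then show "(\<lambda>\<omega>. from_nat (nat \<lfloor>\<omega> 0\<rfloor>) :: 'a) \<in> PiM (UNIV :: nat set) (\<lambda>_. borel :: real measure) \<rightarrow>\<^sub>M count_space UNIV"
    by (rule measurable_compose) simp
qed (auto intro!: measurable_PiM_single' simp: space_PiM)

lemma sequence_embeddable_pair:
  assumes "sequence_embeddable M" "sequence_embeddable N"
  shows "sequence_embeddable (M \<Otimes>\<^sub>M N)"
proof -
  let ?R = "PiM (UNIV :: nat set) (\<lambda>_. borel :: real measure)"
  obtain f g where [measurable]: "f \<in> M \<rightarrow>\<^sub>M ?R" "g \<in> ?R \<rightarrow>\<^sub>M M"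
    and inv1: "\<forall>x\<in>space M. g (f x) = x"
    using assms(1) unfolding sequence_embeddable_def by (elim exE conjE)
  obtain f' g' where [measurable]: "f' \<in> N \<rightarrow>\<^sub>M ?R" "g' \<in> ?R \<rightarrow>\<^sub>M N"
    and inv2: "\<forall>x\<in>space N. g' (f' x) = x"
    using assms(2) unfolding sequence_embeddable_def by (elim exE conjE)
  have [measurable]: "(\<lambda>\<omega> n. \<omega> (2 * n)) \<in> ?R \<rightarrow>\<^sub>M ?R" "(\<lambda>\<omega> n. \<omega> (2 * n + 1)) \<in> ?R \<rightarrow>\<^sub>M ?R"
    by (intro measurable_PiM_single'; auto)+
  show ?thesis
    unfolding sequence_embeddable_def
  proof (intro exI[of _ "\<lambda>p n. if even n then f (fst p) (n div 2) else f' (snd p) (n div 2)"]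
      exI[of _ "\<lambda>\<omega>. (g (\<lambda>n. \<omega> (2 * n)), g' (\<lambda>n. \<omega> (2 * n + 1)))"] conjI)
    show "(\<lambda>p n. if even n then f (fst p) (n div 2) else f' (snd p) (n div 2)) \<in> M \<Otimes>\<^sub>M N \<rightarrow>\<^sub>M ?R"
      by (intro measurable_PiM_single') auto
    show "(\<lambda>\<omega>. (g (\<lambda>n. \<omega> (2 * n)), g' (\<lambda>n. \<omega> (2 * n + 1)))) \<in> ?R \<rightarrow>\<^sub>M M \<Otimes>\<^sub>M N"
      by measurable
  qed (use inv1 inv2 in \<open>auto simp: space_pair_measure\<close>)
qed

lemma sequence_embeddable_PiM:
  fixes M :: "'i::countable \<Rightarrow> 'a measure"
  assumes "\<And>i. sequence_embeddable (M i)"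
  shows "sequence_embeddable (PiM UNIV M)"
proof -
  let ?R = "PiM (UNIV :: nat set) (\<lambda>_. borel :: real measure)"
  let ?Q = "\<lambda>i f g. f \<in> M i \<rightarrow>\<^sub>M ?R \<and> g \<in> ?R \<rightarrow>\<^sub>M M i \<and> (\<forall>x\<in>space (M i). g (f x) = x)"
  have "\<forall>i. \<exists>f g. ?Q i f g"
    using assms unfolding sequence_embeddable_def by (rule allI)
  from choice[OF this] obtain f where "\<forall>i. \<exists>g. ?Q i (f i) g" ..
  from choice[OF this] obtain g where fg: "\<forall>i. ?Q i (f i) (g i)" ..
  have [measurable]: "f i \<in> M i \<rightarrow>\<^sub>M ?R" "g i \<in> ?R \<rightarrow>\<^sub>M M i" for i
    using fg by simp_all
  have inv: "g i (f i x) = x" if "x \<in> space (M i)" for i x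
    using fg that by simp
  show ?thesis
    unfolding sequence_embeddable_def
  proof (intro exI conjI ballI)
    let ?f = "\<lambda>x n. f (from_nat (fst (prod_decode n))) (x (from_nat (fst (prod_decode n)))) (snd (prod_decode n))"
    let ?g = "\<lambda>\<omega> i. g i (\<lambda>n. \<omega> (prod_encode (to_nat i, n)))"
    show "?f \<in> PiM UNIV M \<rightarrow>\<^sub>M ?R"
    proof (intro measurable_PiM_single')
      fix n :: nat
      let ?i = "from_nat (fst (prod_decode n)) :: 'i"
      have "(\<lambda>x. f ?i (x ?i)) \<in> PiM UNIV M \<rightarrow>\<^sub>M ?R"
        by measurable
      then show "(\<lambda>x. ?f x n) \<in> borel_measurable (PiM UNIV M)"
        by measurable
    qed auto
    have [measurable]: "(\<lambda>\<omega> n. \<omega> (prod_encode (to_nat i, n))) \<in> ?R \<rightarrow>\<^sub>M ?R" for i :: 'i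
      by (intro measurable_PiM_single') auto
    show "?g \<in> ?R \<rightarrow>\<^sub>M PiM UNIV M"
    proof (intro measurable_PiM_single')
      show "(\<lambda>\<omega>. ?g \<omega> i) \<in> ?R \<rightarrow>\<^sub>M M i" for i
        by measurable
      then show "?g \<in> space ?R \<rightarrow> (\<Pi>\<^sub>E i\<in>UNIV. space (M i))"
        by (auto intro: measurable_space)
    qed
    show "?g (?f x) = x" if "x \<in> space (PiM UNIV M)" for x
      using that inv by (auto simp: space_PiM PiE_def Pi_def)
  qed
qed

lemma sequence_embeddable_noise: "sequence_embeddable (noise q)"
  by (subst sequence_embeddable_cong[OF sets_noise])
    (intro sequence_embeddable_PiM sequence_embeddable_pair sequence_embeddable_borel sequence_embeddable_count_space)

section \<open>Couplings from coupled rates\<close>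

lemma chain_state_Suc': "chain_state (Suc n) x c = snd (c n) (chain_state n x c)"
proof (induction n arbitrary: x c)
  case (Suc n)
  have "chain_state (Suc (Suc n)) x c = chain_state (Suc n) (snd (c 0) x) (\<lambda>i. c (Suc i))"
    by simp
  also have "\<dots> = snd (c (Suc n)) (chain_state n (snd (c 0) x) (\<lambda>i. c (Suc i)))"
    by (rule Suc.IH)
  finally show ?case by simp
qed simp

lemma AE_noise_in_support:
  fixes q :: "'s::countable \<Rightarrow> 's \<Rightarrow> real"
  shows "AE c in noise q. \<forall>i x. snd (c i) x \<in> set_pmf (jump_pmf q x)"
proof -
  interpret U: prob_space "PiM UNIV (\<lambda>x. measure_pmf (jump_pmf q x))" by (rule prob_space_succ_noise)
  interpret E: prob_space "density lborel (exponential_density 1)" by (rule prob_space_exponential_noise)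
  interpret pair_prob_space "density lborel (exponential_density 1)" "PiM UNIV (\<lambda>x. measure_pmf (jump_pmf q x))" ..
  have AE_u: "AE u in PiM UNIV (\<lambda>x. measure_pmf (jump_pmf q x)). u x \<in> set_pmf (jump_pmf q x)" for x
    by (rule AE_PiM_component) (auto intro: measure_pmf.prob_space_axioms AE_pmfI)
  have "AE a in step_noise q. snd a x \<in> set_pmf (jump_pmf q x)" for x
    unfolding step_noise_def
  proof (rule AE_pair_measure)
    have "(\<lambda>a. snd a x) \<in> density lborel (exponential_density 1) \<Otimes>\<^sub>M PiM UNIV (\<lambda>x. measure_pmf (jump_pmf q x)) \<rightarrow>\<^sub>M count_space UNIV"
      by (rule measurable_compose[OF measurable_snd])
         (rule measurable_compose[OF measurable_component_singleton], auto)
    then have "Measurable.pred (density lborel (exponential_density 1) \<Otimes>\<^sub>M PiM UNIV (\<lambda>x. measure_pmf (jump_pmf q x)))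
        (\<lambda>a. snd a x \<in> set_pmf (jump_pmf q x))"
      by (rule measurable_compose) simp
    then show "{a \<in> space (density lborel (exponential_density 1) \<Otimes>\<^sub>M PiM UNIV (\<lambda>x. measure_pmf (jump_pmf q x))).
        snd a x \<in> set_pmf (jump_pmf q x)} \<in> sets (density lborel (exponential_density 1) \<Otimes>\<^sub>M PiM UNIV (\<lambda>x. measure_pmf (jump_pmf q x)))"
      by (rule predE)
  qed (use AE_u in simp)
  then have "AE a in step_noise q. \<forall>x. snd a x \<in> set_pmf (jump_pmf q x)"
    by (simp add: AE_all_countable)
  then have "AE c in noise q. \<forall>x. snd (c i) x \<in> set_pmf (jump_pmf q x)" for i
    unfolding noise_def by (rule AE_PiM_component[OF prob_space_step_noise UNIV_I])
  then show ?thesis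
    by (simp add: AE_all_countable)
qed

lemma distr_pair_fst_fst_snd:
  assumes "prob_space A" "prob_space B" "prob_space C"
  shows "distr (A \<Otimes>\<^sub>M (B \<Otimes>\<^sub>M C)) (A \<Otimes>\<^sub>M B) (\<lambda>p. (fst p, fst (snd p))) = A \<Otimes>\<^sub>M B"
    and "distr (A \<Otimes>\<^sub>M (B \<Otimes>\<^sub>M C)) (A \<Otimes>\<^sub>M C) (\<lambda>p. (fst p, snd (snd p))) = A \<Otimes>\<^sub>M C"
proof -
  interpret A: prob_space A by fact
  interpret B: prob_space B by fact
  interpret C: prob_space C by fact
  interpret BC: pair_prob_space B C ..
  have "A \<Otimes>\<^sub>M B = distr (A \<Otimes>\<^sub>M (B \<Otimes>\<^sub>M C)) (A \<Otimes>\<^sub>M B) (\<lambda>p. (fst p, fst (snd p)))"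
  proof (rule pair_measure_eqI)
    fix X Y assume [measurable]: "X \<in> sets A" "Y \<in> sets B"
    have "(\<lambda>p. (fst p, fst (snd p))) -` (X \<times> Y) \<inter> space (A \<Otimes>\<^sub>M (B \<Otimes>\<^sub>M C)) = X \<times> (Y \<times> space C)"
      using sets.sets_into_space[of X A] sets.sets_into_space[of Y B] by (auto simp: space_pair_measure)
    then show "emeasure A X * emeasure B Y = emeasure (distr (A \<Otimes>\<^sub>M (B \<Otimes>\<^sub>M C)) (A \<Otimes>\<^sub>M B) (\<lambda>p. (fst p, fst (snd p)))) (X \<times> Y)"
      by (simp add: emeasure_distr BC.emeasure_pair_measure_Times C.emeasure_pair_measure_Times C.emeasure_space_1)
  qed (auto intro: A.sigma_finite_measure_axioms B.sigma_finite_measure_axioms)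
  then show "distr (A \<Otimes>\<^sub>M (B \<Otimes>\<^sub>M C)) (A \<Otimes>\<^sub>M B) (\<lambda>p. (fst p, fst (snd p))) = A \<Otimes>\<^sub>M B" ..
  have "A \<Otimes>\<^sub>M C = distr (A \<Otimes>\<^sub>M (B \<Otimes>\<^sub>M C)) (A \<Otimes>\<^sub>M C) (\<lambda>p. (fst p, snd (snd p)))"
  proof (rule pair_measure_eqI)
    fix X Y assume [measurable]: "X \<in> sets A" "Y \<in> sets C"
    have "(\<lambda>p. (fst p, snd (snd p))) -` (X \<times> Y) \<inter> space (A \<Otimes>\<^sub>M (B \<Otimes>\<^sub>M C)) = X \<times> (space B \<times> Y)"
      using sets.sets_into_space[of X A] sets.sets_into_space[of Y C] by (auto simp: space_pair_measure)
    then show "emeasure A X * emeasure C Y = emeasure (distr (A \<Otimes>\<^sub>M (B \<Otimes>\<^sub>M C)) (A \<Otimes>\<^sub>M C) (\<lambda>p. (fst p, snd (snd p)))) (X \<times> Y)"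
      by (simp add: emeasure_distr BC.emeasure_pair_measure_Times C.emeasure_pair_measure_Times B.emeasure_space_1)
  qed (auto intro: A.sigma_finite_measure_axioms C.sigma_finite_measure_axioms)
  then show "distr (A \<Otimes>\<^sub>M (B \<Otimes>\<^sub>M C)) (A \<Otimes>\<^sub>M C) (\<lambda>p. (fst p, snd (snd p))) = A \<Otimes>\<^sub>M C" ..
qed

lemma coupled_paths_in_invariant:
  fixes qW :: "('s::countable \<times> 's) \<Rightarrow> ('s \<times> 's) \<Rightarrow> real"
  assumes qW: "finite_rates qW"
    and w0: "w0 \<in> I"
    and inv: "\<And>w w'. w \<in> I \<Longrightarrow> w' \<noteq> w \<Longrightarrow> qW w w' \<noteq> 0 \<Longrightarrow> w' \<in> I"
    and c: "\<And>i w. snd (c i) w \<in> set_pmf (jump_pmf qW w)"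
    and SX: "SX = lump_hold_lim fst qW qX w0 c e" and ZX: "ZX = lump_state_lim fst w0 c e"
    and SY: "SY = lump_hold_lim snd qW qY w0 c f" and ZY: "ZY = lump_state_lim snd w0 c f"
    and alive: "alive SX t" "alive SY t"
  shows "(path_at ZX SX t, path_at ZY SY t) \<in> I"
proof -
  define W where "W n = chain_state n w0 c" for n
  define T where "T n = chain_hold qW n w0 c" for n
  have step: "W (Suc n) \<in> set_pmf (jump_pmf qW (W n))" for n
    unfolding W_def chain_state_Suc' by (rule c)
  have WI: "W n \<in> I" for n
  proof (induction n)
    case (Suc n)
    show ?case
      using step[of n] Suc inv[of "W n" "W (Suc n)"]
      by (auto simp: set_jump_pmf[OF qW] jump_prob_def split: if_splits)
  qed (simp add: W_def w0)
  show ?thesis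
  proof (cases "\<exists>m. t < (\<Sum>i<Suc m. T i)")
    case True
    then obtain m where m: "t < (\<Sum>i<Suc m. T i)" and least: "\<And>m'. m' < m \<Longrightarrow> \<not> t < (\<Sum>i<Suc m'. T i)"
      using exists_least_iff[of "\<lambda>m. t < (\<Sum>i<Suc m. T i)"] by blast
    have ge: "(\<Sum>i<m. T i) \<le> t"
      using least[of "m - 1"] by (cases m) (auto simp: not_less)
    obtain n where "ZX n = fst (W m)" "(\<Sum>k<n. SX k) \<le> t" "t < (\<Sum>k<Suc n. SX k)"
      using lump_path[where m=m and qW=qW and w=w0 and c=c and t=t and pr=fst and e=e and q=qX] ge m unfolding T_def W_def SX ZX by blast
    then have X: "path_at ZX SX t = fst (W m)"
      using path_at_eq by metis
    obtain n where "ZY n = snd (W m)" "(\<Sum>k<n. SY k) \<le> t" "t < (\<Sum>k<Suc n. SY k)"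
      using lump_path[where m=m and qW=qW and w=w0 and c=c and t=t and pr=snd and e=f and q=qY] ge m unfolding T_def W_def SY ZY by blast
    then have Y: "path_at ZY SY t = snd (W m)"
      using path_at_eq by metis
    show ?thesis
      using WI[of m] by (simp add: X Y)
  next
    case False
    then have le: "(\<Sum>i<Suc m. T i) \<le> t" for m
      by (auto simp: not_less)
    obtain n n' where n: "t < (\<Sum>k<Suc n. SX k)" and n': "t < (\<Sum>k<Suc n'. SY k)"
      using alive by (auto simp: alive_def)
    have "t < top" using n by (rule order.strict_trans2) simp
    have moves: "W (Suc i) \<noteq> W i" for i
    proof -
      have "T i \<le> (\<Sum>j<Suc i. T j)" by simp
      also have "\<dots> \<le> t" by (rule le)
      finally have "T i < top" using \<open>t < top\<close> by simp
      then have "total_rate qW (W i) > 0"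
        using total_rate_nonneg[OF qW, of "W i"]
        by (auto simp: T_def W_def chain_hold_def hold_def order.order_iff_strict split: if_splits)
      then show ?thesis
        using step[of i] by (auto simp: set_jump_pmf[OF qW] jump_prob_def split: if_splits)
    qed
    define cX where "cX m = (\<Sum>i<m. if fst (W (Suc i)) \<noteq> fst (W i) then 1 else 0 :: nat)" for m
    define cY where "cY m = (\<Sum>i<m. if snd (W (Suc i)) \<noteq> snd (W i) then 1 else 0 :: nat)" for m
    have "m \<le> cX m + cY m" for m
    proof -
      have "m = (\<Sum>i<m. 1)" by simp
      also have "\<dots> \<le> cX m + cY m"
        unfolding cX_def cY_def sum.distrib[symmetric]
        by (intro sum_mono) (use moves in \<open>auto simp: prod_eq_iff\<close>)
      finally show ?thesis .
    qed
    from this[of "Suc n + Suc n'"]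
    have "Suc n \<le> cX (Suc n + Suc n') \<or> Suc n' \<le> cY (Suc n + Suc n')" by linarith
    moreover have "(\<Sum>i<Suc n + Suc n'. T i) \<le> t"
      using le[of "Suc n + n'"] by simp
    ultimately have "(\<Sum>k<Suc n. SX k) \<le> t \<or> (\<Sum>k<Suc n'. SY k) \<le> t"
      using lump_hold_sum_le[where n="Suc n" and m="Suc n + Suc n'" and pr=fst and w=w0 and c=c and qW=qW and q=qX and e=e]
        lump_hold_sum_le[where n="Suc n'" and m="Suc n + Suc n'" and pr=snd and w=w0 and c=c and qW=qW and q=qY and e=f]
      unfolding cX_def cY_def W_def T_def SX SY by (meson order.trans)
    with n n' show ?thesis by auto
  qed
qed

text \<open>Beyond its explosion time a path is unconstrained, so it may there follow the other path.\<close>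

theorem markov_coupling:
  fixes qX qY :: "'s::countable \<Rightarrow> 's \<Rightarrow> real"
  assumes X: "lumping qW qX fst" and Y: "lumping qW qY snd"
    and w0: "(x0, y0) \<in> I"
    and inv: "\<And>w w'. w \<in> I \<Longrightarrow> w' \<noteq> w \<Longrightarrow> qW w w' \<noteq> 0 \<Longrightarrow> w' \<in> I"
    and refl: "\<And>z. (z, z) \<in> I"
  shows "\<exists>(P :: (nat \<Rightarrow> real) measure) X Y. prob_space P \<and> is_ctmc P qX x0 X \<and> is_ctmc P qY y0 Y \<and>
    (AE \<omega> in P. \<forall>t\<ge>0. (X t \<omega>, Y t \<omega>) \<in> I)"
proof -
  interpret X: lumping qW qX fst by fact
  interpret Y: lumping qW qY snd by fact
  let ?Q = "noise qW \<Otimes>\<^sub>M (noise qX \<Otimes>\<^sub>M noise qY)"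
  let ?R = "PiM (UNIV :: nat set) (\<lambda>_. borel :: real measure)"
  interpret Q: prob_space ?Q
    by (intro prob_space_pair prob_space_noise)
  have "sequence_embeddable ?Q"
    by (intro sequence_embeddable_pair sequence_embeddable_noise)
  then obtain f g where f [measurable]: "f \<in> ?Q \<rightarrow>\<^sub>M ?R" and g [measurable]: "g \<in> ?R \<rightarrow>\<^sub>M ?Q"
    and gf: "\<forall>x\<in>space ?Q. g (f x) = x"
    unfolding sequence_embeddable_def by (elim exE conjE)
  define P where "P = distr ?Q ?R f"
  have g' [measurable]: "g \<in> P \<rightarrow>\<^sub>M ?Q"
    by (simp add: P_def)
  have Q: "distr P ?Q g = ?Q"
  proof -
    have "distr P ?Q g = distr ?Q ?Q (\<lambda>x. g (f x))"
      unfolding P_def by (subst distr_distr) (auto simp: comp_def)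
    also have "\<dots> = distr ?Q ?Q (\<lambda>x. x)"
      using gf by (intro distr_cong) auto
    finally show ?thesis by simp
  qed
  interpret P: prob_space P
    unfolding P_def by (rule Q.prob_space_distr) measurable
  define ZX where "ZX p = lump_state_lim fst (x0, y0) (fst p) (fst (snd p))" for p :: "_ \<times> _ \<times> (nat \<Rightarrow> real \<times> ('s \<Rightarrow> 's))"
  define SX where "SX p = lump_hold_lim fst qW qX (x0, y0) (fst p) (fst (snd p))" for p :: "_ \<times> _ \<times> (nat \<Rightarrow> real \<times> ('s \<Rightarrow> 's))"
  define ZY where "ZY p = lump_state_lim snd (x0, y0) (fst p) (snd (snd p))" for p :: "_ \<times> (nat \<Rightarrow> real \<times> ('s \<Rightarrow> 's)) \<times> _"
  define SY where "SY p = lump_hold_lim snd qW qY (x0, y0) (fst p) (snd (snd p))" for p :: "_ \<times> (nat \<Rightarrow> real \<times> ('s \<Rightarrow> 's)) \<times> _"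
  have "ctmc_law ?Q qX x0 ZX SX"
    using ctmc_law_distr[OF X.lump_law_lim[of "(x0, y0)"] _ distr_pair_fst_fst_snd(1)[OF prob_space_noise prob_space_noise prob_space_noise]]
    by (simp add: ZX_def[abs_def] SX_def[abs_def])
  then have lawX: "ctmc_law P qX x0 (\<lambda>\<omega>. ZX (g \<omega>)) (\<lambda>\<omega>. SX (g \<omega>))"
    by (rule ctmc_law_distr[OF _ g' Q])
  have "ctmc_law ?Q qY y0 ZY SY"
    using ctmc_law_distr[OF Y.lump_law_lim[of "(x0, y0)"] _ distr_pair_fst_fst_snd(2)[OF prob_space_noise prob_space_noise prob_space_noise]]
    by (simp add: ZY_def[abs_def] SY_def[abs_def])
  then have lawY: "ctmc_law P qY y0 (\<lambda>\<omega>. ZY (g \<omega>)) (\<lambda>\<omega>. SY (g \<omega>))"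
    by (rule ctmc_law_distr[OF _ g' Q])
  define pX where "pX t \<omega> = path_at (ZX (g \<omega>)) (SX (g \<omega>)) (ennreal t)" for t \<omega>
  define pY where "pY t \<omega> = path_at (ZY (g \<omega>)) (SY (g \<omega>)) (ennreal t)" for t \<omega>
  define aX where "aX t \<omega> = alive (SX (g \<omega>)) (ennreal t)" for t \<omega>
  define aY where "aY t \<omega> = alive (SY (g \<omega>)) (ennreal t)" for t \<omega>
  define X where "X t \<omega> = (if aX t \<omega> then pX t \<omega> else if aY t \<omega> then pY t \<omega> else x0)" for t \<omega>
  define Y where "Y t \<omega> = (if aY t \<omega> then pY t \<omega> else if aX t \<omega> then pX t \<omega> else x0)" for t \<omega>
  have "is_ctmc P qX x0 X"
    using lawX by (rule is_ctmcI) (simp add: X_def aX_def pX_def)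
  moreover have "is_ctmc P qY y0 Y"
    using lawY by (rule is_ctmcI) (simp add: Y_def aY_def pY_def)
  moreover have "AE \<omega> in P. \<forall>t\<ge>0. (X t \<omega>, Y t \<omega>) \<in> I"
  proof -
    interpret XY: prob_space "noise qX \<Otimes>\<^sub>M noise qY"
      by (intro prob_space_pair prob_space_noise)
    have "AE c in distr ?Q (noise qW) fst. \<forall>i x. snd (c i) x \<in> set_pmf (jump_pmf qW x)"
      unfolding XY.distr_pair_fst by (rule AE_noise_in_support)
    then have "AE p in distr P ?Q g. \<forall>i x. snd (fst p i) x \<in> set_pmf (jump_pmf qW x)"
      unfolding Q by (rule AE_distrD[rotated]) measurable
    then have "AE \<omega> in P. \<forall>i x. snd (fst (g \<omega>) i) x \<in> set_pmf (jump_pmf qW x)"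
      by (rule AE_distrD[rotated]) measurable
    then show ?thesis
    proof eventually_elim
      case (elim \<omega>)
      have "(pX t \<omega>, pY t \<omega>) \<in> I" if "aX t \<omega>" "aY t \<omega>" for t
        using that elim unfolding aX_def aY_def pX_def pY_def
        by (intro coupled_paths_in_invariant[OF X.finite_qW w0 inv, where c="fst (g \<omega>)"]) 
          (auto simp: ZX_def SX_def ZY_def SY_def)
      then show ?case
        by (auto simp: X_def Y_def refl)
    qed
  qed
  ultimately show ?thesis
    using P.prob_space_axioms by blast
qed

section \<open>Mass-action networks\<close>

lemma falling_fact_eq_0: "x < n \<Longrightarrow> falling_fact (real x) n = 0"
  unfolding falling_fact_def by (intro prod_zero) (auto intro!: bexI[of _ x])

lemma falling_fact_nonneg: "0 \<le> falling_fact (real x) n"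
  by (cases "n \<le> x") (auto simp: falling_fact_eq_0, auto simp: falling_fact_def intro!: prod_nonneg)

lemma falling_fact_mono: "x \<le> y \<Longrightarrow> falling_fact (real x) n \<le> falling_fact (real y) n"
  by (cases "n \<le> x") (auto simp: falling_fact_eq_0 falling_fact_nonneg, auto simp: falling_fact_def intro!: prod_mono)

lemma propensity_nonneg: "0 \<le> kappa r \<Longrightarrow> 0 \<le> propensity kappa nu r x"
  unfolding propensity_def by (intro mult_nonneg_nonneg prod_nonneg falling_fact_nonneg ballI)

lemma propensity_nonzeroD: "propensity kappa nu r x \<noteq> 0 \<Longrightarrow> nu r j \<le> x j"
  unfolding propensity_def using falling_fact_eq_0[of "x j" "nu r j"] by (cases "nu r j \<le> x j") auto

lemma propensity_mono:
  assumes "0 \<le> kX r" "kX r \<le> kY r" and le: "\<And>j. nu r j \<noteq> 0 \<Longrightarrow> x j \<le> y j"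
  shows "propensity kX nu r x \<le> propensity kY nu r y"
  unfolding propensity_def
proof (intro mult_mono prod_mono conjI falling_fact_nonneg prod_nonneg ballI)
  show "falling_fact (real (x j)) (nu r j) \<le> falling_fact (real (y j)) (nu r j)" for j
    using le[of j] by (cases "nu r j = 0") (auto simp: falling_fact_def falling_fact_mono[unfolded falling_fact_def])
qed (use assms in auto)

definition react :: "('r \<Rightarrow> 'n \<Rightarrow> nat) \<Rightarrow> ('r \<Rightarrow> 'n \<Rightarrow> nat) \<Rightarrow> 'r \<Rightarrow> ('n \<Rightarrow> nat) \<Rightarrow> 'n \<Rightarrow> nat" where
  "react nu nu' r x j = x j + nu' r j - nu r j"

lemma int_react:
  "propensity kappa nu r x \<noteq> 0 \<Longrightarrow> int (react nu nu' r x j) = int (x j) + rvec nu nu' r j"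
  using propensity_nonzeroD[of kappa nu r x j] by (simp add: react_def rvec_def of_nat_diff)

lemma react_eq_iff:
  assumes "propensity kappa nu r x \<noteq> 0"
  shows "react nu nu' r x = z \<longleftrightarrow> (\<forall>j. int (z j) - int (x j) = rvec nu nu' r j)"
proof -
  have "react nu nu' r x j = z j \<longleftrightarrow> int (z j) - int (x j) = rvec nu nu' r j" for j
    using int_react[OF assms, of nu' j] by linarith
  then show ?thesis by (simp add: fun_eq_iff)
qed

lemma ma_rates_eq_sum:
  assumes "z \<noteq> x"
  shows "ma_rates kappa nu nu' x z = (\<Sum>r\<in>UNIV. if react nu nu' r x = z then propensity kappa nu r x else 0)"
proof -
  have "ma_rates kappa nu nu' x z = (\<Sum>r\<in>UNIV. if \<forall>j. int (z j) - int (x j) = rvec nu nu' r j then propensity kappa nu r x else 0)"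
    using assms by (simp add: ma_rates_def sum.If_cases)
  also have "\<dots> = (\<Sum>r\<in>UNIV. if react nu nu' r x = z then propensity kappa nu r x else 0)"
  proof (intro sum.cong refl)
    show "(if \<forall>j. int (z j) - int (x j) = rvec nu nu' r j then propensity kappa nu r x else 0)
      = (if react nu nu' r x = z then propensity kappa nu r x else 0)" for r
      using react_eq_iff[of kappa nu r x nu' z] by (cases "propensity kappa nu r x = 0") simp_all
  qed
  finally show ?thesis .
qed

lemma finite_rates_ma_rates:
  assumes "\<forall>r. 0 \<le> kappa r"
  shows "finite_rates (ma_rates kappa nu nu')"
  unfolding finite_rates_def
proof (intro conjI allI)
  show "0 \<le> ma_rates kappa nu nu' x z" for x z
    using assms by (auto simp: ma_rates_def intro!: sum_nonneg propensity_nonneg)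
  have "z \<in> range (\<lambda>r. react nu nu' r x)" if nz: "ma_rates kappa nu nu' x z \<noteq> 0" for x z
  proof -
    have "z \<noteq> x" using nz by (auto simp: ma_rates_def)
    with nz show ?thesis
      unfolding ma_rates_eq_sum[OF \<open>z \<noteq> x\<close>] by (elim sum.not_neutral_contains_not_neutral) (auto split: if_splits)
  qed
  then have "{z. ma_rates kappa nu nu' x z \<noteq> 0} \<subseteq> range (\<lambda>r. react nu nu' r x)" for x
    by blast
  then show "finite {z. ma_rates kappa nu nu' x z \<noteq> 0}" for x
    by (rule finite_subset) simp
qed

definition coupled_rates :: "('r::finite \<Rightarrow> real) \<Rightarrow> ('r \<Rightarrow> real) \<Rightarrow> ('r \<Rightarrow> 'n::finite \<Rightarrow> nat) \<Rightarrow> ('r \<Rightarrow> 'n \<Rightarrow> nat)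
    \<Rightarrow> ('n \<Rightarrow> nat) \<times> ('n \<Rightarrow> nat) \<Rightarrow> ('n \<Rightarrow> nat) \<times> ('n \<Rightarrow> nat) \<Rightarrow> real" where
  "coupled_rates kX kY nu nu' w w' = (\<Sum>r\<in>UNIV.
    let a = propensity kX nu r (fst w); b = propensity kY nu r (snd w);
      x' = react nu nu' r (fst w); y' = react nu nu' r (snd w)
    in (if w' = (x', y') then min a b else 0)
      + (if w' = (x', snd w) then a - min a b else 0)
      + (if w' = (fst w, y') then b - min a b else 0))"

definition coupled_targets :: "('r \<Rightarrow> 'n \<Rightarrow> nat) \<Rightarrow> ('r \<Rightarrow> 'n \<Rightarrow> nat)
    \<Rightarrow> ('n \<Rightarrow> nat) \<times> ('n \<Rightarrow> nat) \<Rightarrow> (('n \<Rightarrow> nat) \<times> ('n \<Rightarrow> nat)) set" where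
  "coupled_targets nu nu' w = range (\<lambda>r. (react nu nu' r (fst w), react nu nu' r (snd w)))
    \<union> range (\<lambda>r. (react nu nu' r (fst w), snd w)) \<union> range (\<lambda>r. (fst w, react nu nu' r (snd w)))"

lemma finite_coupled_targets: "finite (coupled_targets nu nu' w)" for nu :: "'r::finite \<Rightarrow> 'n \<Rightarrow> nat"
  by (simp add: coupled_targets_def)

lemma coupled_rates_nonzeroD: "coupled_rates kX kY nu nu' w w' \<noteq> 0 \<Longrightarrow> w' \<in> coupled_targets nu nu' w"
  unfolding coupled_rates_def Let_def
  by (elim sum.not_neutral_contains_not_neutral) (auto simp: coupled_targets_def split: if_splits)

lemma finite_rates_coupled_rates:
  assumes "\<forall>r. 0 \<le> kX r" "\<forall>r. 0 \<le> kY r"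
  shows "finite_rates (coupled_rates kX kY nu nu')"
  unfolding finite_rates_def
proof (intro conjI allI)
  show "0 \<le> coupled_rates kX kY nu nu' w w'" for w w'
    using assms by (auto simp: coupled_rates_def Let_def intro!: sum_nonneg add_nonneg_nonneg propensity_nonneg)
  show "finite {w'. coupled_rates kX kY nu nu' w w' \<noteq> 0}" for w
    by (rule finite_subset[OF _ finite_coupled_targets[of nu nu' w]]) (auto dest: coupled_rates_nonzeroD)
qed

lemma coupled_rates_marginal:
  fixes w :: "('n::finite \<Rightarrow> nat) \<times> ('n \<Rightarrow> nat)"
  shows "z \<noteq> fst w \<Longrightarrow> (\<Sum>w' | coupled_rates kX kY nu nu' w w' \<noteq> 0 \<and> fst w' = z. coupled_rates kX kY nu nu' w w')
      = ma_rates kX nu nu' (fst w) z"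
    and "z \<noteq> snd w \<Longrightarrow> (\<Sum>w' | coupled_rates kX kY nu nu' w w' \<noteq> 0 \<and> snd w' = z. coupled_rates kX kY nu nu' w w')
      = ma_rates kY nu nu' (snd w) z"
proof -
  let ?F = "coupled_targets nu nu' w"
  let ?a = "\<lambda>r. propensity kX nu r (fst w)" and ?b = "\<lambda>r. propensity kY nu r (snd w)"
  let ?x = "\<lambda>r. react nu nu' r (fst w)" and ?y = "\<lambda>r. react nu nu' r (snd w)"
  have F: "(?x r, ?y r) \<in> ?F" "(?x r, snd w) \<in> ?F" "(fst w, ?y r) \<in> ?F" for r
    by (auto simp: coupled_targets_def)
  have sum: "(\<Sum>w' | coupled_rates kX kY nu nu' w w' \<noteq> 0 \<and> w' \<in> A. coupled_rates kX kY nu nu' w w')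
    = (\<Sum>r\<in>UNIV. (if (?x r, ?y r) \<in> A then min (?a r) (?b r) else 0)
        + (if (?x r, snd w) \<in> A then ?a r - min (?a r) (?b r) else 0)
        + (if (fst w, ?y r) \<in> A then ?b r - min (?a r) (?b r) else 0))" for A
  proof -
    have fin: "finite (?F \<inter> A)"
      using finite_coupled_targets by blast
    have "(\<Sum>w' | coupled_rates kX kY nu nu' w w' \<noteq> 0 \<and> w' \<in> A. coupled_rates kX kY nu nu' w w')
      = (\<Sum>w'\<in>?F \<inter> A. coupled_rates kX kY nu nu' w w')"
      using fin by (intro sum.mono_neutral_left) (auto dest: coupled_rates_nonzeroD)
    also have "\<dots> = (\<Sum>r\<in>UNIV. \<Sum>w'\<in>?F \<inter> A. (if w' = (?x r, ?y r) then min (?a r) (?b r) else 0)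
      + (if w' = (?x r, snd w) then ?a r - min (?a r) (?b r) else 0)
      + (if w' = (fst w, ?y r) then ?b r - min (?a r) (?b r) else 0))"
      unfolding coupled_rates_def Let_def by (rule sum.swap)
    finally show ?thesis
      using fin F by (simp add: sum.distrib sum.delta)
  qed
  show "(\<Sum>w' | coupled_rates kX kY nu nu' w w' \<noteq> 0 \<and> fst w' = z. coupled_rates kX kY nu nu' w w')
      = ma_rates kX nu nu' (fst w) z" if "z \<noteq> fst w"
    using sum[of "{w'. fst w' = z}"] that by (auto simp: ma_rates_eq_sum intro!: sum.cong)
  show "(\<Sum>w' | coupled_rates kX kY nu nu' w w' \<noteq> 0 \<and> snd w' = z. coupled_rates kX kY nu nu' w w')
      = ma_rates kY nu nu' (snd w) z" if "z \<noteq> snd w"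
    using sum[of "{w'. snd w' = z}"] that by (auto simp: ma_rates_eq_sum intro!: sum.cong)
qed

lemma matvec_add: "matvec M (\<lambda>j. u j + v j) i = matvec M u i + matvec M v i"
  by (simp add: matvec_def algebra_simps sum.distrib)

lemma matvec_diff: "matvec M (\<lambda>j. u j - v j) i = matvec M u i - matvec M v i"
  by (simp add: matvec_def algebra_simps sum_subtractf)

lemma coordinate_eq_matvec:
  fixes d :: "'n::finite \<Rightarrow> int"
  assumes C: "\<And>l. l < k \<Longrightarrow> C l \<in> orth_compl V" and d: "(\<lambda>j. real_of_int (d j)) \<in> V"
    and D: "D_eq_e M k C a b j"
  shows "real_of_int (d j) = (\<Sum>i\<in>UNIV. a i * real_of_int (matvec M d i))"
proof -
  have "real_of_int (d j) = (\<Sum>j'\<in>UNIV. (if j' = j then 1 else 0) * real_of_int (d j'))"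
    by (simp add: if_distrib[of "\<lambda>x. x * _"] cong: if_cong)
  also have "\<dots> = (\<Sum>j'\<in>UNIV. ((\<Sum>i\<in>UNIV. a i * real_of_int (M i j')) + (\<Sum>l<k. b l * C l j')) * real_of_int (d j'))"
    using D unfolding D_eq_e_def by simp
  also have "\<dots> = (\<Sum>j'\<in>UNIV. \<Sum>i\<in>UNIV. a i * real_of_int (M i j') * real_of_int (d j'))
      + (\<Sum>j'\<in>UNIV. \<Sum>l<k. b l * C l j' * real_of_int (d j'))"
    by (simp add: distrib_right sum.distrib sum_distrib_right)
  also have "(\<Sum>j'\<in>UNIV. \<Sum>i\<in>UNIV. a i * real_of_int (M i j') * real_of_int (d j')) = (\<Sum>i\<in>UNIV. a i * real_of_int (matvec M d i))"
    by (subst sum.swap) (simp add: matvec_def sum_distrib_left mult.assoc)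
  also have "(\<Sum>j'\<in>UNIV. \<Sum>l<k. b l * C l j' * real_of_int (d j')) = (\<Sum>l<k. b l * (\<Sum>j'\<in>UNIV. C l j' * real_of_int (d j')))"
    by (subst sum.swap) (simp add: sum_distrib_left mult.assoc)
  also have "\<dots> = 0"
    using C d by (intro sum.neutral) (auto simp: orth_compl_def)
  finally show ?thesis by simp
qed

lemma matA_coordinate_le_0:
  fixes d :: "'n::finite \<Rightarrow> int"
  assumes C: "\<And>l. l < k \<Longrightarrow> C l \<in> orth_compl V" and d: "(\<lambda>j. real_of_int (d j)) \<in> V"
    and A: "matA M k C io j \<noteq> 0"
    and le: "\<And>i. matvec M d i \<le> 0" and eq: "\<And>i. io = Some i \<Longrightarrow> matvec M d i = 0"
  shows "d j \<le> 0"
proof -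
  obtain a b where D: "D_eq_e M k C a b j" and a: "\<And>l. Some l \<noteq> io \<Longrightarrow> a l \<ge> 0"
    using A by (auto simp: matA_def split: if_splits)
  have "(\<Sum>i\<in>UNIV. a i * real_of_int (matvec M d i)) \<le> 0"
  proof (rule sum_nonpos)
    show "a i * real_of_int (matvec M d i) \<le> 0" for i
      using a[of i] le[of i] eq[of i] by (cases "io = Some i") (auto intro: mult_nonneg_nonpos)
  qed
  then show ?thesis
    using coordinate_eq_matvec[OF C d D] by simp
qed

lemma matB_coordinate_ge_0:
  fixes d :: "'n::finite \<Rightarrow> int"
  assumes C: "\<And>l. l < k \<Longrightarrow> C l \<in> orth_compl V" and d: "(\<lambda>j. real_of_int (d j)) \<in> V"
    and B: "matB M k C io j \<noteq> 0"
    and le: "\<And>i. matvec M d i \<le> 0" and eq: "\<And>i. io = Some i \<Longrightarrow> matvec M d i = 0"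
  shows "0 \<le> d j"
proof -
  obtain a b where D: "D_eq_e M k C a b j" and a: "\<And>l. Some l \<noteq> io \<Longrightarrow> a l \<le> 0"
    using B by (auto simp: matB_def split: if_splits)
  have "0 \<le> (\<Sum>i\<in>UNIV. a i * real_of_int (matvec M d i))"
  proof (rule sum_nonneg)
    show "0 \<le> a i * real_of_int (matvec M d i)" for i
      using a[of i] le[of i] eq[of i] by (cases "io = Some i") (auto intro: mult_nonpos_nonpos)
  qed
  then show ?thesis
    using coordinate_eq_matvec[OF C d D] by simp
qed

lemma add_le_0_of_pos_part:
  assumes "\<And>i. u i \<le> 0" and "pos_part g = (\<lambda>_. 0) \<or> (\<exists>i. pos_part g = unit_vec i \<and> u i < 0)"
  shows "u i + g i \<le> 0"
  using assms(2)
proof (elim disjE exE conjE)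
  assume "pos_part g = (\<lambda>_. 0)"
  then have "max (g i) 0 = 0" by (metis pos_part_def)
  with assms(1)[of i] show ?thesis by simp
next
  fix i' assume "pos_part g = unit_vec i'" and neg: "u i' < 0"
  then have "max (g i) 0 = (if i = i' then 1 else 0)" by (metis pos_part_def unit_vec_def)
  with assms(1)[of i] neg show ?thesis by (auto split: if_splits)
qed

lemma stoich_space_add:
  assumes "u \<in> stoich_space nu nu'" "v \<in> stoich_space nu nu'"
  shows "(\<lambda>j. u j + v j) \<in> stoich_space nu nu'"
proof -
  obtain c c' where "u = (\<lambda>j. \<Sum>r\<in>UNIV. c r * real_of_int (rvec nu nu' r j))"
    "v = (\<lambda>j. \<Sum>r\<in>UNIV. c' r * real_of_int (rvec nu nu' r j))"
    using assms by (auto simp: stoich_space_def)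
  then show ?thesis
    by (auto simp: stoich_space_def sum.distrib[symmetric] distrib_right intro!: exI[of _ "\<lambda>r. c r + c' r"])
qed

lemma scaled_rvec_in_stoich_space:
  "(\<lambda>j. s * real_of_int (rvec nu nu' r j)) \<in> stoich_space nu nu'"
proof -
  have "s * real_of_int (rvec nu nu' r j) = (\<Sum>r'\<in>UNIV. (if r' = r then s else 0) * real_of_int (rvec nu nu' r' j))" for j
    by (simp add: if_distrib[of "\<lambda>x. x * _"] cong: if_cong)
  then show ?thesis
    by (auto simp: stoich_space_def)
qed

definition ordered_pairs :: "('m \<Rightarrow> 'n::finite \<Rightarrow> int) \<Rightarrow> ('r::finite \<Rightarrow> 'n \<Rightarrow> nat) \<Rightarrow> ('r \<Rightarrow> 'n \<Rightarrow> nat)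
    \<Rightarrow> (('n \<Rightarrow> nat) \<times> ('n \<Rightarrow> nat)) set" where
  "ordered_pairs M nu nu' = {(x, y). (\<lambda>j. real (x j) - real (y j)) \<in> stoich_space nu nu'
    \<and> (\<forall>i. matvec M (\<lambda>j. int (x j) - int (y j)) i \<le> 0)}"

lemma ordered_pairs_iff:
  "(x, y) \<in> ordered_pairs M nu nu' \<longleftrightarrow> (\<lambda>j. real_of_int (int (x j) - int (y j))) \<in> stoich_space nu nu'
    \<and> (\<forall>i. matvec M (\<lambda>j. int (x j) - int (y j)) i \<le> 0)"
  by (simp add: ordered_pairs_def)

lemma ordered_pairs_refl: "(x, x) \<in> ordered_pairs M nu nu'"
  using scaled_rvec_in_stoich_space[of 0] by (simp add: ordered_pairs_def matvec_def)

lemma ordered_pairs_react_left: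
  assumes C: "\<And>l. l < k \<Longrightarrow> C l \<in> orth_compl (stoich_space nu nu')"
    and k: "0 \<le> kX r" "0 \<le> kY r"
    and condA: "pos_part (matvec M (rvec nu nu' r)) = (\<lambda>_. 0)
               \<or> ((\<forall>j. matA M k C None j * nu r j = nu r j) \<and> kX r \<le> kY r)
               \<or> (\<exists>i. pos_part (matvec M (rvec nu nu' r)) = unit_vec i
                     \<and> (\<forall>j. matA M k C (Some i) j * nu r j = nu r j) \<and> kX r \<le> kY r)"
    and xy: "(x, y) \<in> ordered_pairs M nu nu'"
    and excess: "propensity kY nu r y < propensity kX nu r x"
  shows "(react nu nu' r x, y) \<in> ordered_pairs M nu nu'"
proof -
  define d where "d = (\<lambda>j. int (x j) - int (y j))"
  have dS: "(\<lambda>j. real_of_int (d j)) \<in> stoich_space nu nu'" and dM: "\<And>i. matvec M d i \<le> 0"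
    using xy by (simp_all add: ordered_pairs_iff d_def)
  have nz: "propensity kX nu r x \<noteq> 0"
    using excess propensity_nonneg[of kY r nu y] k by simp
  have diff: "int (react nu nu' r x j) - int (y j) = d j + rvec nu nu' r j" for j
    using int_react[OF nz, of nu' j] by (simp add: d_def)
  have no_excess: False
    if A: "\<forall>j. matA M k C io j * nu r j = nu r j" and "kX r \<le> kY r" and io: "\<And>i. io = Some i \<Longrightarrow> matvec M d i = 0" for io
  proof -
    have "x j \<le> y j" if "nu r j \<noteq> 0" for j
    proof -
      have mat: "matA M k C io j \<noteq> 0"
        using A[rule_format, of j] that by auto
      have "d j \<le> 0"
        by (rule matA_coordinate_le_0[where V="stoich_space nu nu'" and C=C and k=k and M=M and io=io]) (fact C dS mat dM io)+
      then show ?thesis by (simp add: d_def)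
    qed
    then have "propensity kX nu r x \<le> propensity kY nu r y"
      using k \<open>kX r \<le> kY r\<close> by (intro propensity_mono)
    with excess show False by simp
  qed
  have "pos_part (matvec M (rvec nu nu' r)) = (\<lambda>_. 0)
      \<or> (\<exists>i. pos_part (matvec M (rvec nu nu' r)) = unit_vec i \<and> matvec M d i < 0)"
    using condA
  proof (elim disjE exE conjE)
    fix i assume i: "pos_part (matvec M (rvec nu nu' r)) = unit_vec i"
      "\<forall>j. matA M k C (Some i) j * nu r j = nu r j" "kX r \<le> kY r"
    then have "matvec M d i \<noteq> 0"
      using no_excess[of "Some i"] by auto
    with i dM[of i] show ?thesis by (intro disjI2 exI[of _ i]) simp
  qed (use no_excess[of None] in auto)
  then have "matvec M d i + matvec M (rvec nu nu' r) i \<le> 0" for i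
    using add_le_0_of_pos_part[of "matvec M d" "matvec M (rvec nu nu' r)"] dM by blast
  moreover have "(\<lambda>j. real_of_int (d j + rvec nu nu' r j)) \<in> stoich_space nu nu'"
    using stoich_space_add[OF dS scaled_rvec_in_stoich_space[of 1 nu nu' r]] by simp
  ultimately show ?thesis
    by (simp only: ordered_pairs_iff diff matvec_add) simp
qed

lemma ordered_pairs_react_right:
  assumes C: "\<And>l. l < k \<Longrightarrow> C l \<in> orth_compl (stoich_space nu nu')"
    and k: "0 \<le> kX r" "0 \<le> kY r"
    and condB: "neg_part (matvec M (rvec nu nu' r)) = (\<lambda>_. 0)
               \<or> ((\<forall>j. matB M k C None j * nu r j = nu r j) \<and> kX r \<ge> kY r)
               \<or> (\<exists>i. neg_part (matvec M (rvec nu nu' r)) = unit_vec i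
                     \<and> (\<forall>j. matB M k C (Some i) j * nu r j = nu r j) \<and> kX r \<ge> kY r)"
    and xy: "(x, y) \<in> ordered_pairs M nu nu'"
    and excess: "propensity kX nu r x < propensity kY nu r y"
  shows "(x, react nu nu' r y) \<in> ordered_pairs M nu nu'"
proof -
  define d where "d = (\<lambda>j. int (x j) - int (y j))"
  have dS: "(\<lambda>j. real_of_int (d j)) \<in> stoich_space nu nu'" and dM: "\<And>i. matvec M d i \<le> 0"
    using xy by (simp_all add: ordered_pairs_iff d_def)
  have nz: "propensity kY nu r y \<noteq> 0"
    using excess propensity_nonneg[of kX r nu x] k by simp
  have diff: "int (x j) - int (react nu nu' r y j) = d j - rvec nu nu' r j" for j
    using int_react[OF nz, of nu' j] by (simp add: d_def)
  have no_excess: False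
    if B: "\<forall>j. matB M k C io j * nu r j = nu r j" and "kY r \<le> kX r" and io: "\<And>i. io = Some i \<Longrightarrow> matvec M d i = 0" for io
  proof -
    have "y j \<le> x j" if "nu r j \<noteq> 0" for j
    proof -
      have mat: "matB M k C io j \<noteq> 0"
        using B[rule_format, of j] that by auto
      have "0 \<le> d j"
        by (rule matB_coordinate_ge_0[where V="stoich_space nu nu'" and C=C and k=k and M=M and io=io]) (fact C dS mat dM io)+
      then show ?thesis by (simp add: d_def)
    qed
    then have "propensity kY nu r y \<le> propensity kX nu r x"
      using k \<open>kY r \<le> kX r\<close> by (intro propensity_mono)
    with excess show False by simp
  qed
  have neg: "neg_part (matvec M (rvec nu nu' r)) = pos_part (\<lambda>i. - matvec M (rvec nu nu' r) i)"
    by (simp add: neg_part_def pos_part_def fun_eq_iff)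
  have "pos_part (\<lambda>i. - matvec M (rvec nu nu' r) i) = (\<lambda>_. 0)
      \<or> (\<exists>i. pos_part (\<lambda>i. - matvec M (rvec nu nu' r) i) = unit_vec i \<and> matvec M d i < 0)"
    using condB unfolding neg
  proof (elim disjE exE conjE)
    fix i assume i: "pos_part (\<lambda>i. - matvec M (rvec nu nu' r) i) = unit_vec i"
      "\<forall>j. matB M k C (Some i) j * nu r j = nu r j" "kY r \<le> kX r"
    then have "matvec M d i \<noteq> 0"
      using no_excess[of "Some i"] by auto
    with i dM[of i] show ?thesis by (intro disjI2 exI[of _ i]) simp
  qed (use no_excess[of None] in auto)
  then have "matvec M d i + - matvec M (rvec nu nu' r) i \<le> 0" for i
    using add_le_0_of_pos_part[of "matvec M d" "\<lambda>i. - matvec M (rvec nu nu' r) i"] dM by blast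
  moreover have "(\<lambda>j. real_of_int (d j - rvec nu nu' r j)) \<in> stoich_space nu nu'"
    using stoich_space_add[OF dS scaled_rvec_in_stoich_space[of "-1" nu nu' r]] by simp
  ultimately show ?thesis
    by (simp only: ordered_pairs_iff diff matvec_diff) simp
qed

lemma ordered_pairs_react_both:
  assumes "(x, y) \<in> ordered_pairs M nu nu'" "propensity kX nu r x \<noteq> 0" "propensity kY nu r y \<noteq> 0"
  shows "(react nu nu' r x, react nu nu' r y) \<in> ordered_pairs M nu nu'"
  using assms(1) unfolding ordered_pairs_iff int_react[OF assms(2)] int_react[OF assms(3)] by simp

theorem theorem4p1:
  fixes nu nu' :: "'r::finite \<Rightarrow> 'n::finite \<Rightarrow> nat"
    and kX kY :: "'r \<Rightarrow> real"
    and k :: nat and C :: "nat \<Rightarrow> 'n \<Rightarrow> real"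
    and M :: "'m::finite \<Rightarrow> 'n \<Rightarrow> int"
    and x0 y0 :: "'n \<Rightarrow> nat"
  assumes reactions: "inj (\<lambda>r. (nu r, nu' r))"
    and C_basis: "rows_basis_of k C (orth_compl (stoich_space nu nu'))"
    and kX_nonneg: "\<forall>r. 0 \<le> kX r" and kY_nonneg: "\<forall>r. 0 \<le> kY r"
    and condA: "\<forall>r. pos_part (matvec M (rvec nu nu' r)) = (\<lambda>_. 0)
               \<or> ((\<forall>j. matA M k C None j * nu r j = nu r j) \<and> kX r \<le> kY r)
               \<or> (\<exists>i. pos_part (matvec M (rvec nu nu' r)) = unit_vec i
                     \<and> (\<forall>j. matA M k C (Some i) j * nu r j = nu r j) \<and> kX r \<le> kY r)"
    and condB: "\<forall>r. neg_part (matvec M (rvec nu nu' r)) = (\<lambda>_. 0)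
               \<or> ((\<forall>j. matB M k C None j * nu r j = nu r j) \<and> kX r \<ge> kY r)
               \<or> (\<exists>i. neg_part (matvec M (rvec nu nu' r)) = unit_vec i
                     \<and> (\<forall>j. matB M k C (Some i) j * nu r j = nu r j) \<and> kX r \<ge> kY r)"
    and init_S: "(\<lambda>j. real (x0 j) - real (y0 j)) \<in> stoich_space nu nu'"
    and init_M: "\<forall>i. matvec M (\<lambda>j. int (x0 j) - int (y0 j)) i \<le> 0"
  shows "\<exists>(P :: (nat \<Rightarrow> real) measure) X Y.
           prob_space P \<and>
           is_ctmc P (ma_rates kX nu nu') x0 X \<and>
           is_ctmc P (ma_rates kY nu nu') y0 Y \<and>
           (AE \<omega> in P. \<forall>t::real. 0 \<le> t \<and> ennreal t < explosion_time (\<lambda>s. X s \<omega>)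
                  \<and> ennreal t < explosion_time (\<lambda>s. Y s \<omega>) \<longrightarrow>
                  (\<forall>i. matvec M (\<lambda>j. int (X t \<omega> j) - int (Y t \<omega> j)) i \<le> 0))"
proof -
  let ?q = "coupled_rates kX kY nu nu'" and ?I = "ordered_pairs M nu nu'"
  have C: "\<And>l. l < k \<Longrightarrow> C l \<in> orth_compl (stoich_space nu nu')"
    using C_basis by (simp add: rows_basis_of_def)
  have fin: "finite_rates ?q" "finite_rates (ma_rates kX nu nu')" "finite_rates (ma_rates kY nu nu')"
    using kX_nonneg kY_nonneg by (simp_all add: finite_rates_coupled_rates finite_rates_ma_rates)
  have "lumping ?q (ma_rates kX nu nu') fst" "lumping ?q (ma_rates kY nu nu') snd"
    using fin by (unfold_locales; simp add: coupled_rates_marginal)+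
  moreover have "(x0, y0) \<in> ?I"
    using init_S init_M by (simp add: ordered_pairs_def)
  moreover have "w' \<in> ?I" if w: "w \<in> ?I" and rate: "?q w w' \<noteq> 0" for w w'
  proof -
    obtain x y where xy: "w = (x, y)" by (cases w)
    from rate obtain r where "(if w' = (react nu nu' r x, react nu nu' r y) then min (propensity kX nu r x) (propensity kY nu r y) else 0)
      + (if w' = (react nu nu' r x, y) then propensity kX nu r x - min (propensity kX nu r x) (propensity kY nu r y) else 0)
      + (if w' = (x, react nu nu' r y) then propensity kY nu r y - min (propensity kX nu r x) (propensity kY nu r y) else 0) \<noteq> 0"
      unfolding coupled_rates_def Let_def xy fst_conv snd_conv by (rule sum.not_neutral_contains_not_neutral)
    then consider "min (propensity kX nu r x) (propensity kY nu r y) \<noteq> 0" "w' = (react nu nu' r x, react nu nu' r y)"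
      | "propensity kY nu r y < propensity kX nu r x" "w' = (react nu nu' r x, y)"
      | "propensity kX nu r x < propensity kY nu r y" "w' = (x, react nu nu' r y)"
      by (smt (verit, best))
    then show ?thesis
    proof cases
      case 1
      moreover have "0 \<le> propensity kX nu r x" "0 \<le> propensity kY nu r y"
        using kX_nonneg kY_nonneg by (simp_all add: propensity_nonneg)
      ultimately show ?thesis
        using w unfolding xy by (auto simp: min_def intro!: ordered_pairs_react_both[of _ _ _ _ _ kX _ kY] split: if_splits)
    next
      case 2
      show ?thesis
        unfolding 2(2)
        by (rule ordered_pairs_react_left[where k=k and C=C and nu=nu and nu'=nu' and kX=kX and kY=kY and r=r and M=M and x=x and y=y,
            OF C spec[OF kX_nonneg] spec[OF kY_nonneg] spec[OF condA] w[unfolded xy] 2(1)])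
    next
      case 3
      show ?thesis
        unfolding 3(2)
        by (rule ordered_pairs_react_right[where k=k and C=C and nu=nu and nu'=nu' and kX=kX and kY=kY and r=r and M=M and x=x and y=y,
            OF C spec[OF kX_nonneg] spec[OF kY_nonneg] spec[OF condB] w[unfolded xy] 3(1)])
    qed
  qed
  ultimately have "\<exists>(P :: (nat \<Rightarrow> real) measure) X Y. prob_space P \<and> is_ctmc P (ma_rates kX nu nu') x0 X
      \<and> is_ctmc P (ma_rates kY nu nu') y0 Y \<and> (AE \<omega> in P. \<forall>t\<ge>0. (X t \<omega>, Y t \<omega>) \<in> ?I)"
    by (intro markov_coupling[of ?q]) (auto intro: ordered_pairs_refl)
  then obtain P :: "(nat \<Rightarrow> real) measure" and X Y where P: "prob_space P"
    "is_ctmc P (ma_rates kX nu nu') x0 X" "is_ctmc P (ma_rates kY nu nu') y0 Y"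
    and ord: "AE \<omega> in P. \<forall>t\<ge>0. (X t \<omega>, Y t \<omega>) \<in> ?I"
    by (elim exE conjE)
  from ord have "AE \<omega> in P. \<forall>t::real. 0 \<le> t \<and> ennreal t < explosion_time (\<lambda>s. X s \<omega>)
      \<and> ennreal t < explosion_time (\<lambda>s. Y s \<omega>) \<longrightarrow>
      (\<forall>i. matvec M (\<lambda>j. int (X t \<omega> j) - int (Y t \<omega> j)) i \<le> 0)"
    by eventually_elim (simp add: ordered_pairs_def)
  with P show ?thesis by blast
qed

end
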